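(* Let $m\ge 1$, let $\mathfrak{I}^{(m)}$ be the set of all involutions (of all lengths $n\ge 0$) having no descending subsequence of length $m+1$, let $f(\tau)$ denote the number of fixed points of $\tau$, and let $p\ge 0$ be an integer. For $i\in\mathbb{Z}$ let $$I_i=\sum_{n\ge\max(0,-i)}\frac{t^{2n+i}}{n!\,(n+i)!}.$$ If $m=2\ell+1$, then $$\sum_{\tau\in\mathfrak{I}^{(m)},\ f(\tau)=p}\frac{t^{|\tau|}}{|\tau|!}=\frac{t^p}{p!}\,\det\left(I_{i-j}-I_{i+j}\right)_{1\le i,j\le\ell}.$$ If $m=2\ell$, then $$\sum_{\tau\in\mathfrak{I}^{(m)},\ f(\tau)=p}\frac{t^{|\tau|}}{|\tau|!}=\det\begin{pmatrix}\left(I_{p+\ell-j}-I_{p+\ell+j}\right)_{1\le j\le\ell}\\ \left(I_{i+j-1}-I_{i-j-1}\right)_{2\le i\le\ell,\ 1\le j\le\ell}\end{pmatrix},$$ the determinant of the $\ell\times\ell$ matrix whose first row has $j$-th entry $I_{p+\ell-j}-I_{p+\ell+j}$, and whose $i$-th row, for $i=2,\dots,\ell$, has $j$-th entry $I_{i+j-1}-I_{i-j-1}$.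
   Context: An involution of length $n$ is a permutation $\tau$ of $\{1,\dots,n\}$ with $\tau\circ\tau=\mathrm{id}$; $|\tau|=n$ is its length, and the empty permutation (length $0$) is included. A descending subsequence of $\tau$ of length $k$ is a $k$-tuple $(\tau(i_1),\dots,\tau(i_k))$ with $i_1<\cdots<i_k$ and $\tau(i_1)>\cdots>\tau(i_k)$. An empty determinant equals $1$. Identities are between formal power series in $t$. *)

theory Defs
  imports
    "HOL-Analysis.Infinite_Sum"
    "HOL-Computational_Algebra.Formal_Power_Series"
    "HOL-Combinatorics.Permutations"
    "Jordan_Normal_Form.Determinant"
begin

(* An involution is the pair of its length n and a map on nat that permutes {1..n} and is the
   identity elsewhere. The length has to be recorded, since e.g. the identity map belongs to
   every n. *)

definition is_involution :: "nat \<times> (nat \<Rightarrow> nat) \<Rightarrow> bool" where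
  "is_involution = (\<lambda>(n, \<tau>). \<tau> permutes {1..n} \<and> \<tau> \<circ> \<tau> = id)"

definition descending_subsequence :: "nat list \<Rightarrow> nat \<times> (nat \<Rightarrow> nat) \<Rightarrow> bool" where
  "descending_subsequence ds = (\<lambda>(n, \<tau>). \<exists>is. set is \<subseteq> {1..n} \<and> sorted_wrt (<) is \<and>
     ds = map \<tau> is \<and> sorted_wrt (>) ds)"

definition involutions :: "nat \<Rightarrow> (nat \<times> (nat \<Rightarrow> nat)) set" where
  "involutions m = {\<sigma>. is_involution \<sigma> \<and>
     \<not> (\<exists>ds. descending_subsequence ds \<sigma> \<and> length ds = m + 1)}"

definition fixed_points :: "nat \<times> (nat \<Rightarrow> nat) \<Rightarrow> nat" where
  "fixed_points = (\<lambda>(n, \<tau>). card {i \<in> {1..n}. \<tau> i = i})"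

(* c t^k. Infinite sums of such terms are taken in the library topology of fps, in which
   convergence means that each coefficient is eventually constant (tendsto_fps_iff). *)

definition term_fps :: "rat \<Rightarrow> nat \<Rightarrow> rat fps" where
  "term_fps c k = fps_const c * fps_X ^ k"

definition I_fps :: "int \<Rightarrow> rat fps" where
  "I_fps i = (\<Sum>\<^sub>\<infinity>n | int n \<ge> max 0 (- i).
     term_fps (1 / (fact n * fact (nat (int n + i)))) (nat (2 * int n + i)))"

(* The determinant of (a i j) with 1 <= i, j <= l; matrices of the library are indexed from 0. *)

definition det1 :: "nat \<Rightarrow> (int \<Rightarrow> int \<Rightarrow> rat fps) \<Rightarrow> rat fps" where
  "det1 l a = det (mat l l (\<lambda>(r, c). a (int r + 1) (int c + 1)))"

lemma det1_0 [simp]: "det1 0 a = 1"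
  by (simp add: det1_def)

lemma has_sum_term_fps:
  assumes fin: "\<And>k. finite {x \<in> A. d x = k}"
  shows "((\<lambda>x. term_fps (c x) (d x)) has_sum Abs_fps (\<lambda>k. \<Sum>x | x \<in> A \<and> d x = k. c x)) A"
  unfolding has_sum_def
proof (rule tendsto_fpsI)
  fix k
  have "\<forall>\<^sub>F F in finite_subsets_at_top A. finite F \<and> {x \<in> A. d x = k} \<subseteq> F \<and> F \<subseteq> A"
    unfolding eventually_finite_subsets_at_top using fin by blast
  thus "\<forall>\<^sub>F F in finite_subsets_at_top A. fps_nth (\<Sum>x\<in>F. term_fps (c x) (d x)) k =
      fps_nth (Abs_fps (\<lambda>k. \<Sum>x | x \<in> A \<and> d x = k. c x)) k"
  proof eventually_elim
    case (elim F)
    have "fps_nth (\<Sum>x\<in>F. term_fps (c x) (d x)) k = (\<Sum>x\<in>F. if d x = k then c x else 0)"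
      by (auto simp: fps_sum_nth term_fps_def fps_X_power_nth intro!: sum.cong)
    also have "\<dots> = (\<Sum>x | x \<in> A \<and> d x = k. c x)"
      using elim by (intro sum.mono_neutral_cong_right) auto
    finally show ?case by simp
  qed
qed

lemma has_sum_I_fps:
  "((\<lambda>n. term_fps (1 / (fact n * fact (nat (int n + i)))) (nat (2 * int n + i))) has_sum I_fps i)
     {n. int n \<ge> max 0 (- i)}"
proof -
  have "finite {n \<in> {n. int n \<ge> max 0 (- i)}. nat (2 * int n + i) = k}" for k
    by (rule finite_subset[of _ "{..k}"]) auto
  from has_sum_term_fps[where c = "\<lambda>n. 1 / (fact n * fact (nat (int n + i)))", OF this]
  show ?thesis unfolding I_fps_def by (blast intro: has_sum_infsum has_sum_imp_summable)
qed

end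

theory Submission
  imports Defs
begin

text \<open>
  Read an involution from left to right. An arc (a 2-cycle) is open between its two ends; call the
  length of the longest chain of closed arcs nested inside an open arc its rank (when \<open>m\<close> is even,
  a chain over a fixed point counts one more). Avoiding a descending subsequence of length
  \<open>m + 1\<close> means that no arc of rank \<open>l\<close> is ever closed, so the number of ways to complete a
  partial involution depends only on the list of ranks of its open arcs and satisfies a simple
  recursion.

  The same recursion is solved by determinants. Let \<open>W x = det (g\<^sub>j (x\<^sub>i))\<close>, where
  \<open>\<partial>/\<partial>t g\<^sub>j(a) = g\<^sub>j(a + 1) + g\<^sub>j(a - 1)\<close>, let \<open>X\<^sub>i\<close> be the shift of the \<open>i\<close>-th coordinate, and put
  \<open>T\<^sub>r = X\<^sub>r + \<dots> + X\<^sub>l\<^sub>-\<^sub>1\<close>. The exponential generating function of the completions of the rank list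
  \<open>r\<^sub>1, \<dots>, r\<^sub>k\<close> is \<open>T\<^bsub>r\<^sub>1\<^esub> \<cdots> T\<^bsub>r\<^sub>k\<^esub> W\<close> at \<open>(1, \<dots>, l)\<close>: by \<open>T\<^sub>r = T\<^sub>r\<^sub>+\<^sub>1 + X\<^sub>r\<close>, moving the backward
  steps of the derivative past the operators \<open>T\<close> produces exactly the closings, and what remains
  vanishes by antisymmetry of \<open>W\<close>, except for the boundary term of the first coordinate. With odd
  \<open>g\<^sub>j\<close> there is none. To count fixed points by a weight \<open>y\<close> for even \<open>m\<close>, one needs the boundary
  condition \<open>g\<^sub>j(0) = y g\<^sub>j(1)\<close>, which is obtained by replacing an odd \<open>g(a)\<close> by \<open>g(a) - y g(a - 1)\<close>.
\<close>

section \<open>The series \<open>I\<^sub>i\<close>\<close>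

text \<open>The value 0 at negative arguments makes \<open>a / a! = 1 / (a - 1)!\<close> true for
  every integer \<open>a\<close>, including 0, and absorbs the range condition on \<open>n\<close>
  in \<open>I_fps i\<close>.\<close>

definition recip_fact :: "int \<Rightarrow> rat" where
  "recip_fact a = (if a < 0 then 0 else 1 / fact (nat a))"

lemma recip_fact_0 [simp]: "recip_fact 0 = 1"
  by (simp add: recip_fact_def)

lemma recip_fact_rec: "of_int a * recip_fact a = recip_fact (a - 1)"
proof (cases "a \<le> 0")
  case False
  then obtain n where "a = int (Suc n)"
    by (metis not0_implies_Suc not_le of_nat_0_less_iff less_irrefl zero_less_imp_eq_int)
  moreover have "(1 + of_nat n :: rat) \<noteq> 0"
    by (metis of_nat_Suc of_nat_eq_0_iff nat.distinct(1))
  ultimately show ?thesis by (simp add: recip_fact_def nat_add_distrib)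
qed (auto simp: recip_fact_def)

text \<open>Only \<open>n = (k - i) / 2\<close> contributes to the power \<open>t^k\<close>.\<close>

lemma fps_nth_I_fps:
  "fps_nth (I_fps i) k =
     (if even (int k + i) then recip_fact ((int k - i) div 2) * recip_fact ((int k + i) div 2) else 0)"
proof -
  let ?A = "{n. int n \<ge> max 0 (- i)}"
  let ?c = "\<lambda>n. 1 / (fact n * fact (nat (int n + i))) :: rat" and ?d = "\<lambda>n. nat (2 * int n + i)"
  have fin: "finite {n \<in> ?A. ?d n = k}" for k
    by (rule finite_subset[of _ "{..k}"]) auto
  have "I_fps i = Abs_fps (\<lambda>k. \<Sum>n | n \<in> ?A \<and> ?d n = k. ?c n)"
  proof -
    have 1: "((\<lambda>n. term_fps (?c n) (?d n)) has_sum I_fps i) ?A" by (rule has_sum_I_fps)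
    have 2: "((\<lambda>n. term_fps (?c n) (?d n)) has_sum
        Abs_fps (\<lambda>k. \<Sum>n | n \<in> ?A \<and> ?d n = k. ?c n)) ?A"
      using fin by (rule has_sum_term_fps)
    show ?thesis
      using 1 2 unfolding has_sum_def by (rule tendsto_unique[OF finite_subsets_at_top_neq_bot])
  qed
  hence *: "fps_nth (I_fps i) k = (\<Sum>n | n \<in> ?A \<and> ?d n = k. ?c n)" by simp
  show ?thesis
  proof (cases "even (int k + i) \<and> \<bar>i\<bar> \<le> int k")
    case True
    define n where "n = nat ((int k - i) div 2)"
    from True obtain b where b: "int k + i = 2 * b" by blast
    have n: "int n = b - i" "b = int n + i" "(int k - i) div 2 = int n" "(int k + i) div 2 = int n + i"
      using True b by (auto simp: n_def)
    have "{n. n \<in> ?A \<and> ?d n = k} = {n}" using n b True by auto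
    with * have "fps_nth (I_fps i) k = ?c n" by simp
    moreover have "int n + i \<ge> 0" using True n by linarith
    ultimately show ?thesis using True unfolding n(3,4) by (simp add: recip_fact_def)
  next
    case False
    have "even (int k + i) \<and> \<bar>i\<bar> \<le> int k" if "n \<in> ?A" "?d n = k" for n
    proof -
      have "int k = 2 * int n + i" "int n \<ge> - i" using that by auto
      thus ?thesis by auto
    qed
    with False have 0: "{n. n \<in> ?A \<and> ?d n = k} = {}" by blast
    have "recip_fact ((int k - i) div 2) * recip_fact ((int k + i) div 2) = 0"
      if "even (int k + i)" using that False by (auto simp: recip_fact_def)
    thus ?thesis using * unfolding 0 by auto
  qed
qed

lemma fps_nth_I_fps_even:
  assumes "int k - i = 2 * a" "int k + i = 2 * b"
  shows "fps_nth (I_fps i) k = recip_fact a * recip_fact b"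
  by (simp add: fps_nth_I_fps assms)

lemma I_fps_minus: "I_fps (- i) = I_fps i"
  by (rule fps_ext) (simp add: fps_nth_I_fps)

lemma I_fps_nth_0: "fps_nth (I_fps i) 0 = (if i = 0 then 1 else 0)"
  by (auto simp: fps_nth_I_fps recip_fact_def elim!: evenE)

text \<open>With \<open>a + b = k + 1\<close> and \<open>b - a = i\<close>, the coefficient
  \<open>(a + b) / (a! b!)\<close> splits into
  \<open>1 / ((a - 1)! b!) + 1 / (a! (b - 1)!)\<close>.\<close>

lemma fps_deriv_I_fps: "fps_deriv (I_fps i) = I_fps (i + 1) + I_fps (i - 1)"
proof (rule fps_ext)
  fix k
  show "fps_nth (fps_deriv (I_fps i)) k = fps_nth (I_fps (i + 1) + I_fps (i - 1)) k"
  proof (cases "even (int k + 1 + i)")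
    case True
    then obtain b where b: "int k + 1 + i = 2 * b" by blast
    define a where "a = int k + 1 - b"
    have ab: "i = b - a" "int k = a + b - 1" using b by (auto simp: a_def)
    have k: "(of_nat (k + 1) :: rat) = of_int a + of_int b"
      using ab(2) by (metis add.commute diff_add_cancel of_int_add of_int_of_nat_eq of_nat_1 of_nat_add)
    have e: "(2 * a - 2) div 2 = a - 1" "(2 * b - 2) div 2 = b - 1" by auto
    have "of_nat (k + 1) * (recip_fact a * recip_fact b)
        = (of_int a * recip_fact a) * recip_fact b + recip_fact a * (of_int b * recip_fact b)"
      unfolding k by (simp add: algebra_simps)
    hence "of_nat (k + 1) * (recip_fact a * recip_fact b)
        = recip_fact (a - 1) * recip_fact b + recip_fact a * recip_fact (b - 1)"
      by (simp only: recip_fact_rec)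
    moreover have "fps_nth (I_fps i) (k + 1) = recip_fact a * recip_fact b"
      "fps_nth (I_fps (i + 1)) k = recip_fact (a - 1) * recip_fact b"
      "fps_nth (I_fps (i - 1)) k = recip_fact a * recip_fact (b - 1)"
      using ab by (intro fps_nth_I_fps_even; simp)+
    ultimately show ?thesis by simp
  next
    case False
    thus ?thesis by (auto simp: fps_nth_I_fps)
  qed
qed

text \<open>Reflection principle: a source at \<open>r\<close> minus its mirror image at
  \<open>- r\<close> gives a solution of the same equation that is odd in \<open>x\<close>.\<close>

definition kappa :: "int \<Rightarrow> int \<Rightarrow> rat fps" where
  "kappa r x = I_fps (x - r) - I_fps (x + r)"

lemma fps_deriv_kappa: "fps_deriv (kappa r x) = kappa r (x + 1) + kappa r (x - 1)"
  by (simp add: kappa_def fps_deriv_I_fps algebra_simps)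

lemma kappa_0 [simp]: "kappa r 0 = 0"
  by (simp add: kappa_def I_fps_minus)

lemma kappa_minus: "kappa r (- x) = - kappa r x"
  using I_fps_minus[of "x + r"] I_fps_minus[of "x - r"] by (simp add: kappa_def minus_diff_commute)

lemma kappa_nth_0: "x \<ge> 0 \<Longrightarrow> r > 0 \<Longrightarrow> fps_nth (kappa r x) 0 = (if x = r then 1 else 0)"
  by (simp add: kappa_def I_fps_nth_0)

section \<open>Completions of a list of ranks\<close>

text \<open>Arcs opened before the closed one now enclose it, so their ranks must exceed its rank;
  arcs opened after it cross it and keep theirs.\<close>

definition close_arc :: "nat \<Rightarrow> nat list \<Rightarrow> nat list" where
  "close_arc s rs = map (max (Suc (rs ! s))) (take s rs) @ drop (Suc s) rs"

text \<open>A list contains the ranks of the open arcs in the order of their left ends. The four summands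
  stand for opening an arc, closing one, and the two effects that a fixed point can have: none
  (\<open>m\<close> odd, weight \<open>z\<close>), or raising all ranks to at least 1 (\<open>m\<close> even, weight \<open>w\<close>).\<close>

fun completions :: "nat \<Rightarrow> rat \<Rightarrow> rat \<Rightarrow> nat \<Rightarrow> nat list \<Rightarrow> rat" where
  "completions l z w 0 rs = (if rs = [] then 1 else 0)"
| "completions l z w (Suc n) rs =
     completions l z w n (rs @ [0])
     + (\<Sum>s | s < length rs \<and> rs ! s < l. completions l z w n (close_arc s rs))
     + z * completions l z w n rs + w * completions l z w n (map (max 1) rs)"

section \<open>Shift operators and their commutation with backward steps\<close>

definition shift_sum :: "nat \<Rightarrow> nat \<Rightarrow> ((nat \<Rightarrow> int) \<Rightarrow> 'a) \<Rightarrow> (nat \<Rightarrow> int) \<Rightarrow> 'a::ab_group_add" where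
  "shift_sum l r f x = (\<Sum>i=r..<l. f (x(i := x i + 1)))"

definition shift_back :: "nat \<Rightarrow> ((nat \<Rightarrow> int) \<Rightarrow> 'a) \<Rightarrow> (nat \<Rightarrow> int) \<Rightarrow> 'a::ab_group_add" where
  "shift_back i f x = f (x(i := x i - 1))"

text \<open>The product of the operators \<open>T\<^sub>r\<close> of the overview. A factor with
  \<open>r \<ge> l\<close> is an empty sum, just as an arc of such a rank can no longer be
  closed.\<close>

definition shift_sums :: "nat \<Rightarrow> nat list \<Rightarrow> ((nat \<Rightarrow> int) \<Rightarrow> 'a) \<Rightarrow> (nat \<Rightarrow> int) \<Rightarrow> 'a::ab_group_add" where
  "shift_sums l rs f = foldr (shift_sum l) rs f"

lemma shift_sums_simps [simp]:
  "shift_sums l [] f = f"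
  "shift_sums l (r # rs) f = shift_sum l r (shift_sums l rs f)"
  "shift_sums l (rs @ [r]) f = shift_sums l rs (shift_sum l r f)"
  by (simp_all add: shift_sums_def)

lemma fun_upd_swap_add:
  "(x(i := x i + a))(j := (x(i := x i + a)) j + b) = (x(j := x j + b))(i := (x(j := x j + b)) i + a)"
  for x :: "'i \<Rightarrow> int"
  by (auto simp: fun_eq_iff)

lemma shift_back_shift_sum: "shift_back i (shift_sum l r f) = shift_sum l r (shift_back i f)"
  unfolding shift_back_def shift_sum_def
  using fun_upd_swap_add[where a = "-1" and b = 1 and i = i]
  by (intro ext sum.cong refl) (simp del: fun_upd_apply)

lemma shift_back_shift_sums: "shift_back i (shift_sums l rs f) = shift_sums l rs (shift_back i f)"
  by (induction rs) (simp_all add: shift_back_shift_sum)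

lemma shift_sum_add: "shift_sum l r (\<lambda>x. f x + g x) x = shift_sum l r f x + shift_sum l r g x"
  by (simp add: shift_sum_def sum.distrib)

lemma shift_sum_sum: "shift_sum l r (\<lambda>x. \<Sum>a\<in>A. g a x) x = (\<Sum>a\<in>A. shift_sum l r (g a) x)"
  by (simp add: shift_sum_def sum.swap[of _ A])

lemma shift_sums_add: "shift_sums l rs (\<lambda>x. f x + g x) x = shift_sums l rs f x + shift_sums l rs g x"
proof (induction rs arbitrary: x)
  case (Cons r rs)
  thus ?case by (simp add: shift_sum_def sum.distrib del: fun_upd_apply)
qed simp

lemma shift_sums_sum:
  "shift_sums l rs (\<lambda>x. \<Sum>a\<in>A. g a x) x = (\<Sum>a\<in>A. shift_sums l rs (g a) x)"
proof (induction rs arbitrary: x)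
  case (Cons r rs)
  thus ?case by (simp add: shift_sum_def sum.swap[of _ A] del: fun_upd_apply)
qed simp

lemma shift_sums_scale:
  fixes f :: "(nat \<Rightarrow> int) \<Rightarrow> 'a :: ring"
  shows "shift_sums l rs (\<lambda>x. a * f x) x = a * shift_sums l rs f x"
proof (induction rs arbitrary: x)
  case (Cons r rs)
  thus ?case by (simp add: shift_sum_def sum_distrib_left del: fun_upd_apply)
qed simp

text \<open>Applied below to differentiation and to taking the constant coefficient.\<close>

lemma shift_sums_hom:
  assumes "\<And>a b. h (a + b) = h a + h b"
  shows "h (shift_sums l rs f x) = shift_sums l rs (\<lambda>x. h (f x)) x"
proof (induction rs arbitrary: x)
  case (Cons r rs)
  have 0: "h 0 = 0" using assms[of 0 0] by simp
  have "h (sum g A) = (\<Sum>a\<in>A. h (g a))" if "finite A" for g and A :: "nat set"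
    using that by (induction A) (auto simp: 0 assms)
  with Cons show ?case by (simp add: shift_sum_def del: fun_upd_apply)
qed simp

lemma shift_sum_rec:
  assumes "i < l"
  shows "shift_sum l i f x = shift_sum l (Suc i) f x + f (x(i := x i + 1))"
  using assms by (simp add: shift_sum_def sum.atLeast_Suc_lessThan)

text \<open>Commuting a backward step past the forward steps: a factor of the list which equals
  \<open>i\<close> is split as \<open>shift_sum l (Suc i)\<close> plus the step in direction \<open>i\<close>, and the latter
  cancels the backward step.\<close>

lemma shift_back_shift_sums_close:
  assumes "sorted_wrt (\<ge>) rs" "i < l"
  shows "shift_back i (shift_sums l rs f) x =
    (\<Sum>s | s < length rs \<and> rs ! s = i. shift_sums l (close_arc s rs) f x)
    + shift_back i (shift_sums l (map (\<lambda>r. if r = i then Suc i else r) rs) f) x"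
  using assms(1)
proof (induction rs arbitrary: x)
  case (Cons r rs)
  let ?u = "\<lambda>r. if r = i then Suc i else r"
  let ?S = "\<lambda>rs. {s. s < length rs \<and> rs ! s = i}"
  have srt: "sorted_wrt (\<ge>) rs" and le: "\<forall>q\<in>set rs. q \<le> r" using Cons.prems by auto
  have S: "?S (r # rs) = (if r = i then {0} else {}) \<union> Suc ` ?S rs"
    by (auto simp: less_Suc_eq_0_disj image_iff)
  have sum_S: "(\<Sum>s\<in>?S (r # rs). shift_sums l (close_arc s (r # rs)) f x)
      = (if r = i then shift_sums l rs f x else 0)
        + (\<Sum>s\<in>?S rs. shift_sum l (max (Suc i) r) (shift_sums l (close_arc s rs) f) x)"
  proof -
    have "(\<Sum>s\<in>Suc ` ?S rs. shift_sums l (close_arc s (r # rs)) f x)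
        = (\<Sum>s\<in>?S rs. shift_sum l (max (Suc i) r) (shift_sums l (close_arc s rs) f) x)"
      by (subst sum.reindex) (auto simp: close_arc_def intro!: sum.cong)
    moreover have "(\<Sum>s\<in>?S (r # rs). shift_sums l (close_arc s (r # rs)) f x)
       = (\<Sum>s\<in>(if r = i then {0} else {}). shift_sums l (close_arc s (r # rs)) f x)
         + (\<Sum>s\<in>Suc ` ?S rs. shift_sums l (close_arc s (r # rs)) f x)"
      unfolding S by (rule sum.union_disjoint) auto
    ultimately show ?thesis by (auto simp: close_arc_def)
  qed
  have IH: "shift_back i (shift_sums l rs f) = (\<lambda>x. (\<Sum>s\<in>?S rs. shift_sums l (close_arc s rs) f x)
      + shift_back i (shift_sums l (map ?u rs) f) x)"
    using Cons.IH[OF srt] by (simp add: fun_eq_iff)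
  show ?case
  proof (cases "r < i")
    \<comment> \<open>Ranks decrease along the list, so all of them are below \<open>i\<close>:
      there is nothing to close and nothing to replace.\<close>
    case True
    hence less: "q < i" if "q \<in> set (r # rs)" for q using le that by fastforce
    have "?S (r # rs) = {}" using less[OF nth_mem] by blast
    moreover have "map ?u (r # rs) = r # rs" using less by (intro map_idI) fastforce
    ultimately show ?thesis by (simp only: sum.empty add_0)
  next
    case False
    have step: "shift_sum l q (shift_back i (shift_sums l rs f)) x
        = (\<Sum>s\<in>?S rs. shift_sum l q (shift_sums l (close_arc s rs) f) x)
          + shift_back i (shift_sum l q (shift_sums l (map ?u rs) f)) x" for q
      unfolding IH shift_sum_add shift_sum_sum shift_back_shift_sum ..
    show ?thesis
    proof (cases "r = i")
      case True
      let ?g = "shift_sums l rs f"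
      \<comment> \<open>The cancelled step leaves \<open>?g x\<close>, which is the summand
        \<open>s = 0\<close>: closing the first arc changes no other rank.\<close>
      have "shift_back i (shift_sum l i ?g) x = shift_back i (shift_sum l (Suc i) ?g) x + ?g x"
        using shift_sum_rec[OF \<open>i < l\<close>, of ?g "x(i := x i - 1)"] by (simp add: shift_back_def)
      hence "shift_back i (shift_sums l (r # rs) f) x = shift_sum l (Suc i) (shift_back i ?g) x + ?g x"
        using True by (simp add: shift_back_shift_sum)
      thus ?thesis unfolding step sum_S using True by (simp add: algebra_simps)
    next
      case False
      with \<open>\<not> r < i\<close> have "r > i" by simp
      hence "shift_back i (shift_sums l (r # rs) f) x = shift_sum l r (shift_back i (shift_sums l rs f)) x"
        by (simp add: shift_back_shift_sum)
      \<comment> \<open>Enclosing a closed arc of rank \<open>i\<close> does not raise a rank that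
        is already above \<open>i\<close>, so the head keeps its operator on both sides.\<close>
      moreover have "max (Suc i) r = r" "?u r = r" "r \<noteq> i" using \<open>r > i\<close> by auto
      ultimately show ?thesis unfolding step sum_S list.map shift_sums_simps by (simp only: if_False add_0)
    qed
  qed
qed (simp add: close_arc_def)

lemma sorted_wrt_close_arc:
  assumes "sorted_wrt (\<ge>) rs" "s < length rs"
  shows "sorted_wrt (\<ge>) (close_arc s rs)"
proof -
  have rs: "rs = take s rs @ rs ! s # drop (Suc s) rs" by (rule id_take_nth_drop[OF assms(2)])
  have "sorted_wrt (\<ge>) (take s rs @ rs ! s # drop (Suc s) rs)" using assms(1) rs by simp
  hence 1: "sorted_wrt (\<ge>) (take s rs)" "sorted_wrt (\<ge>) (drop (Suc s) rs)"
    "\<forall>q\<in>set (drop (Suc s) rs). q \<le> rs ! s"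
    by (auto simp: sorted_wrt_append simp del: append_take_drop_id)
  have "sorted_wrt (\<ge>) (map (max (Suc (rs ! s))) (take s rs))"
    unfolding sorted_wrt_map by (rule sorted_wrt_mono_rel[OF _ 1(1)]) auto
  thus ?thesis using 1 by (fastforce simp: close_arc_def sorted_wrt_append)
qed

lemma length_close_arc [simp]: "s < length rs \<Longrightarrow> length (close_arc s rs) = length rs - 1"
  by (simp add: close_arc_def)

text \<open>Unless \<open>r = Suc i\<close>, the range \<open>{r..<l}\<close> contains both of
  \<open>i\<close> and \<open>Suc i\<close> or neither, so \<open>shift_sum l r\<close> commutes
  with swapping these coordinates.\<close>

lemma shift_sums_antisym:
  fixes f :: "(nat \<Rightarrow> int) \<Rightarrow> 'a :: ab_group_add"
  assumes "\<And>x. f (x \<circ> transpose i (Suc i)) = - f x" "Suc i \<notin> set rs" "Suc i < l"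
  shows "shift_sums l rs f (x \<circ> transpose i (Suc i)) = - shift_sums l rs f x"
  using assms(2)
proof (induction rs arbitrary: x)
  case (Cons r rs)
  let ?t = "transpose i (Suc i)"
  have upd: "(x \<circ> ?t)(j := (x \<circ> ?t) j + 1) = x(?t j := x (?t j) + 1) \<circ> ?t" for j
    by (auto simp: fun_eq_iff transpose_def)
  have im: "?t ` {r..<l} = {r..<l}"
  proof (cases "r \<le> i")
    case True
    thus ?thesis using assms(3) by (intro permutes_image permutes_swap_id) auto
  next
    case False
    hence "r > Suc i" using Cons.prems by auto
    thus ?thesis by (auto simp: transpose_def image_iff)
  qed
  have "shift_sums l (r # rs) f (x \<circ> ?t)
      = (\<Sum>j=r..<l. shift_sums l rs f ((x \<circ> ?t)(j := (x \<circ> ?t) j + 1)))"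
    by (simp only: shift_sums_simps shift_sum_def)
  also have "\<dots> = (\<Sum>j=r..<l. - shift_sums l rs f (x(?t j := x (?t j) + 1)))"
    using Cons.prems by (intro sum.cong refl) (simp only: upd, rule Cons.IH, simp)
  also have "\<dots> = (\<Sum>j\<in>?t ` {r..<l}. - shift_sums l rs f (x(j := x j + 1)))"
    by (subst sum.reindex) auto
  finally show ?case unfolding im by (simp only: shift_sums_simps shift_sum_def sum_negf)
qed (use assms in auto)

text \<open>Expanded, the left side is a sum of values of \<open>f\<close> at the end points of
  paths of \<open>length rs\<close> unit forward steps from \<open>x\<close>.\<close>

lemma shift_sums_eq_0:
  fixes f :: "(nat \<Rightarrow> int) \<Rightarrow> 'a :: ab_group_add"
  assumes "\<And>y. \<forall>i. x i \<le> y i \<Longrightarrow> (\<Sum>i<l. y i - x i) = int (length rs) \<Longrightarrow> f y = 0"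
  shows "shift_sums l rs f x = 0"
  using assms
proof (induction rs arbitrary: x)
  case (Cons r rs)
  have "shift_sums l rs f (x(i := x i + 1)) = 0" if i: "i < l" for i
  proof (rule Cons.IH, rule Cons.prems)
    fix y assume y: "\<forall>j. (x(i := x i + 1)) j \<le> y j"
      and s: "(\<Sum>j<l. y j - (x(i := x i + 1)) j) = int (length rs)"
    show "\<forall>j. x j \<le> y j"
    proof
      fix j show "x j \<le> y j" using y[rule_format, of j] by (auto split: if_splits)
    qed
    have "(\<Sum>j<l. y j - x j) = (\<Sum>j<l. (y j - (x(i := x i + 1)) j) + (if j = i then 1 else 0))"
      by (intro sum.cong) auto
    also have "\<dots> = int (length rs) + 1" using s i by (simp add: sum.distrib)
    finally show "(\<Sum>j<l. y j - x j) = int (length (r # rs))" by simp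
  qed
  thus ?case by (simp add: shift_sum_def)
qed (auto)

text \<open>Operators with \<open>r \<ge> 1\<close> never move coordinate 0. Hence a boundary
  condition known only at \<open>x 0 = 1\<close> can be used underneath them.\<close>

lemma shift_sums_cong_fixed:
  fixes f g :: "(nat \<Rightarrow> int) \<Rightarrow> 'a :: ab_group_add"
  assumes "\<And>y. y 0 = x 0 \<Longrightarrow> f y = g y" "0 \<notin> set rs"
  shows "shift_sums l rs f x = shift_sums l rs g x"
  using assms
proof (induction rs arbitrary: x)
  case (Cons r rs)
  have "shift_sums l rs f (x(i := x i + 1)) = shift_sums l rs g (x(i := x i + 1))" if "i \<ge> r" for i
  proof (rule Cons.IH)
    fix y :: "nat \<Rightarrow> int"
    assume "y 0 = (x(i := x i + 1)) 0"
    thus "f y = g y" using that Cons.prems by (intro Cons.prems) auto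
  qed (use Cons.prems in auto)
  thus ?case by (simp add: shift_sum_def)
qed auto

section \<open>The reflection argument at the point \<open>(1, ..., l)\<close>\<close>

definition rho :: "nat \<Rightarrow> int" where
  "rho i = int i + 1"

text \<open>The initial condition is only required up to distance \<open>M\<close>, since in the even case the first
  column of the determinant is a power series in \<open>y\<close> truncated after \<open>y^M\<close>.\<close>

locale reflectable =
  fixes l M :: nat and z w :: rat and W :: "(nat \<Rightarrow> int) \<Rightarrow> rat fps"
  assumes heat: "\<And>x. fps_deriv (W x) =
      fps_const z * W x + (\<Sum>i<l. W (x(i := x i + 1)) + W (x(i := x i - 1)))"
    and antisym: "\<And>i x. Suc i < l \<Longrightarrow> W (x \<circ> transpose i (Suc i)) = - W x"
    and boundary: "\<And>x. 0 < l \<Longrightarrow> x 0 = 1 \<Longrightarrow> W (x(0 := 0)) = fps_const w * W x"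
    and w_0: "l = 0 \<Longrightarrow> w = 0"
    and initial: "fps_nth (W rho) 0 = 1"
      "\<And>x. \<forall>i. rho i \<le> x i \<Longrightarrow> (\<Sum>i<l. x i - rho i) > 0 \<Longrightarrow> (\<Sum>i<l. x i - rho i) \<le> int M \<Longrightarrow>
         fps_nth (W x) 0 = 0"
begin

text \<open>For \<open>i > 0\<close> the step back from \<open>rho\<close> makes coordinates
  \<open>i - 1\<close> and \<open>i\<close> equal, and the replaced list no longer contains
  \<open>i\<close>, so antisymmetry gives 0. For \<open>i = 0\<close> no operator moves coordinate 0
  any more, and the boundary condition applies.\<close>

lemma shift_back_remainder:
  assumes "i < l"
  shows "shift_back i (shift_sums l (map (\<lambda>r. if r = i then Suc i else r) rs) W) rho =
    (if i = 0 then fps_const w * shift_sums l (map (max 1) rs) W rho else 0)"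
proof (cases i)
  case 0
  have map: "map (\<lambda>r. if r = i then Suc i else r) rs = map (max 1) rs" using 0 by auto
  have "shift_sums l (map (max 1) rs) (shift_back 0 W) rho
      = shift_sums l (map (max 1) rs) (\<lambda>x. fps_const w * W x) rho"
    using boundary assms by (intro shift_sums_cong_fixed) (auto simp: shift_back_def rho_def)
  thus ?thesis using 0 unfolding map by (simp add: shift_back_shift_sums shift_sums_scale)
next
  case (Suc j)
  let ?g = "shift_sums l (map (\<lambda>r. if r = i then Suc i else r) rs) W"
  let ?x = "rho(i := rho i - 1)"
  have fixed: "?x \<circ> transpose j (Suc j) = ?x"
    using Suc by (auto simp: fun_eq_iff rho_def transpose_def)
  have swap: "?g (?x \<circ> transpose j (Suc j)) = - ?g ?x"
    by (rule shift_sums_antisym) (use antisym assms Suc in auto)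
  \<comment> \<open>A series equal to its own negative is 0, seen coefficientwise in the
    rationals.\<close>
  have "fps_nth (?g ?x) k = fps_nth (- ?g ?x) k" for k
    by (rule arg_cong[OF swap[unfolded fixed]])
  hence "fps_nth (?g ?x) k = 0" for k by simp
  hence "?g ?x = 0" by (auto intro: fps_ext)
  thus ?thesis using Suc by (simp add: shift_back_def)
qed

text \<open>Differentiation reproduces the recursion of \<open>completions\<close>: forward steps
  open an arc, backward steps close one or yield the boundary term. The bound by \<open>M\<close>
  survives the induction, since the list grows by at most 1 whenever \<open>n\<close> drops by
  1.\<close>

theorem shift_sums_eq_completions:
  assumes "sorted_wrt (\<ge>) rs" "length rs + n \<le> M"
  shows "fact n * fps_nth (shift_sums l rs W rho) n = completions l z w n rs"
  using assms
proof (induction n arbitrary: rs)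
  case 0
  show ?case
  proof (cases "rs = []")
    case False
    have "fps_nth (shift_sums l rs W rho) 0 = shift_sums l rs (\<lambda>x. fps_nth (W x) 0) rho"
      by (rule shift_sums_hom) simp
    \<comment> \<open>Only points at distance \<open>length rs\<close> from \<open>rho\<close>
      occur, which is positive and at most \<open>M\<close>.\<close>
    also have "\<dots> = 0" using False 0 by (intro shift_sums_eq_0 initial) auto
    finally show ?thesis using False by simp
  qed (simp add: initial)
next
  case (Suc n)
  let ?F = "\<lambda>rs. shift_sums l rs W rho"
  have deriv: "fps_deriv (?F rs) = fps_const z * ?F rs + ?F (rs @ [0])
      + (\<Sum>s | s < length rs \<and> rs ! s < l. ?F (close_arc s rs)) + fps_const w * ?F (map (max 1) rs)"
  proof -
    have "fps_deriv (?F rs) = shift_sums l rs (\<lambda>x. fps_deriv (W x)) rho"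
      by (rule shift_sums_hom) simp
    also have "(\<lambda>x. fps_deriv (W x)) =
        (\<lambda>x. (fps_const z * W x + shift_sum l 0 W x) + (\<Sum>i<l. shift_back i W x))"
      by (simp add: heat shift_sum_def shift_back_def sum.distrib atLeast0LessThan add.assoc)
    also have "shift_sums l rs \<dots> rho = fps_const z * ?F rs + ?F (rs @ [0])
        + (\<Sum>i<l. shift_back i (shift_sums l rs W) rho)"
      unfolding shift_sums_add shift_sums_sum shift_sums_scale
      by (simp add: shift_back_shift_sums)
    also have "(\<Sum>i<l. shift_back i (shift_sums l rs W) rho) =
        (\<Sum>i<l. (\<Sum>s | s < length rs \<and> rs ! s = i. ?F (close_arc s rs))
           + (if i = 0 then fps_const w * ?F (map (max 1) rs) else 0))"
    proof (rule sum.cong)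
      fix i assume "i \<in> {..<l}"
      hence i: "i < l" by simp
      show "shift_back i (shift_sums l rs W) rho
          = (\<Sum>s | s < length rs \<and> rs ! s = i. ?F (close_arc s rs))
            + (if i = 0 then fps_const w * ?F (map (max 1) rs) else 0)"
        unfolding shift_back_shift_sums_close[OF Suc.prems(1) i, of W rho]
          shift_back_remainder[OF i] ..
    qed simp
    \<comment> \<open>For \<open>l = 0\<close> there is no coordinate 0 to supply the boundary term;
      this is where \<open>w_0\<close> enters.\<close>
    also have "\<dots> = (\<Sum>i<l. \<Sum>s | s < length rs \<and> rs ! s = i. ?F (close_arc s rs))
        + fps_const w * ?F (map (max 1) rs)"
      using w_0 by (cases "l = 0") (simp_all add: sum.distrib)
    also have "(\<Sum>i<l. \<Sum>s | s < length rs \<and> rs ! s = i. ?F (close_arc s rs)) =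
        (\<Sum>s\<in>(\<Union>i<l. {s. s < length rs \<and> rs ! s = i}). ?F (close_arc s rs))"
      by (rule sum.UNION_disjoint[symmetric]) auto
    also have "(\<Union>i<l. {s. s < length rs \<and> rs ! s = i}) = {s. s < length rs \<and> rs ! s < l}"
      by auto
    finally show ?thesis by (simp add: add.assoc)
  qed
  have IH: "fact n * fps_nth (?F rs') n = completions l z w n rs'"
    if "sorted_wrt (\<ge>) rs'" "length rs' \<le> Suc (length rs)" for rs'
    using that Suc.prems by (intro Suc.IH) auto
  have "fact (Suc n) * fps_nth (?F rs) (Suc n) = fact n * fps_nth (fps_deriv (?F rs)) n"
    by (simp add: algebra_simps)
  also have "\<dots> = z * (fact n * fps_nth (?F rs) n) + fact n * fps_nth (?F (rs @ [0])) n
      + (\<Sum>s | s < length rs \<and> rs ! s < l. fact n * fps_nth (?F (close_arc s rs)) n)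
      + w * (fact n * fps_nth (?F (map (max 1) rs)) n)"
    unfolding deriv by (simp add: fps_sum_nth sum_distrib_left algebra_simps)
  also have "\<dots> = completions l z w (Suc n) rs"
  proof -
    have m: "sorted_wrt (\<ge>) (map (max 1) rs)"
      unfolding sorted_wrt_map by (rule sorted_wrt_mono_rel[OF _ Suc.prems(1)]) auto
    have c: "(\<Sum>s | s < length rs \<and> rs ! s < l. fact n * fps_nth (?F (close_arc s rs)) n)
        = (\<Sum>s | s < length rs \<and> rs ! s < l. completions l z w n (close_arc s rs))"
      using Suc.prems by (intro sum.cong IH refl) (auto simp: sorted_wrt_close_arc)
    have e: "fact n * fps_nth (?F rs) n = completions l z w n rs"
      "fact n * fps_nth (?F (map (max 1) rs)) n = completions l z w n (map (max 1) rs)"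
      using m Suc.prems by (auto intro: IH)
    have e': "fact n * fps_nth (?F (rs @ [0])) n = completions l z w n (rs @ [0])"
      using Suc.prems by (intro IH) (auto simp: sorted_wrt_append)
    show ?thesis unfolding c e e' completions.simps by (simp only: ac_simps)
  qed
  finally show ?case .
qed

end

section \<open>Determinants\<close>

definition alt_det :: "nat \<Rightarrow> (nat \<Rightarrow> int \<Rightarrow> 'a) \<Rightarrow> (nat \<Rightarrow> int) \<Rightarrow> 'a :: comm_ring_1" where
  "alt_det l g x = det (mat l l (\<lambda>(i, j). g j (x i)))"

lemma alt_det_leibniz:
  "alt_det l g x = (\<Sum>p | p permutes {0..<l}. signof p * (\<Prod>i=0..<l. g (p i) (x i)))"
proof -
  have "(\<Prod>i=0..<l. mat l l (\<lambda>(i, j). g j (x i)) $$ (i, p i)) = (\<Prod>i=0..<l. g (p i) (x i))"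
    if "p permutes {0..<l}" for p
    using permutes_in_image[OF that] by (intro prod.cong) auto
  thus ?thesis unfolding alt_det_def by (subst det_def'[of _ l]) auto
qed

lemma fps_deriv_prod:
  fixes f :: "'b \<Rightarrow> 'a :: comm_ring_1 fps"
  assumes "finite A"
  shows "fps_deriv (prod f A) = (\<Sum>a\<in>A. fps_deriv (f a) * prod f (A - {a}))"
  using assms
proof (induction A)
  case (insert b A)
  have "(\<Sum>a\<in>A. fps_deriv (f a) * prod f (insert b A - {a}))
      = (\<Sum>a\<in>A. f b * (fps_deriv (f a) * prod f (A - {a})))"
  proof (rule sum.cong)
    fix a assume "a \<in> A"
    hence "insert b A - {a} = insert b (A - {a})" using insert by auto
    thus "fps_deriv (f a) * prod f (insert b A - {a}) = f b * (fps_deriv (f a) * prod f (A - {a}))"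
      using insert by (simp add: mult_ac)
  qed simp
  thus ?case using insert by (simp add: sum_distrib_left algebra_simps)
qed simp

text \<open>In every Leibniz summand the product rule differentiates one factor, that is, it acts on
  one coordinate.\<close>

lemma fps_deriv_alt_det:
  assumes "\<And>j a. j < l \<Longrightarrow> fps_deriv (g j a) = g j (a + 1) + g j (a - 1)"
  shows "fps_deriv (alt_det l g x) =
    (\<Sum>i<l. alt_det l g (x(i := x i + 1)) + alt_det l g (x(i := x i - 1)))"
proof -
  have upd: "(\<Prod>k=0..<l. g (p k) ((x(i := a)) k)) = g (p i) a * (\<Prod>k\<in>{0..<l} - {i}. g (p k) (x k))"
    if "i < l" for p i a
    using that by (subst prod.remove[of _ i]) (auto intro!: prod.cong)
  have sgn: "fps_deriv (signof p * f) = signof p * fps_deriv f" for p and f :: "'a fps"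
    by (simp add: sign_def)
  have "fps_deriv (alt_det l g x) = (\<Sum>p | p permutes {0..<l}. signof p *
      (\<Sum>i=0..<l. fps_deriv (g (p i) (x i)) * (\<Prod>k\<in>{0..<l} - {i}. g (p k) (x k))))"
    unfolding alt_det_leibniz fps_deriv_sum sgn by (simp add: fps_deriv_prod)
  also have "\<dots> = (\<Sum>p | p permutes {0..<l}. \<Sum>i=0..<l.
      signof p * (\<Prod>k=0..<l. g (p k) ((x(i := x i + 1)) k))
      + signof p * (\<Prod>k=0..<l. g (p k) ((x(i := x i - 1)) k)))"
    unfolding sum_distrib_left
  proof (intro sum.cong refl)
    fix p i assume p: "p \<in> {p. p permutes {0..<l}}" and i: "i \<in> {0..<l}"
    hence "p i < l" using permutes_in_image[of p "{0..<l}" i] by auto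
    hence d: "fps_deriv (g (p i) (x i)) = g (p i) (x i + 1) + g (p i) (x i - 1)" by (rule assms)
    have "i < l" using i by simp
    show "signof p * (fps_deriv (g (p i) (x i)) * (\<Prod>k\<in>{0..<l} - {i}. g (p k) (x k)))
      = signof p * (\<Prod>k=0..<l. g (p k) ((x(i := x i + 1)) k))
      + signof p * (\<Prod>k=0..<l. g (p k) ((x(i := x i - 1)) k))"
      unfolding upd[OF \<open>i < l\<close>] d by (simp only: distrib_left distrib_right)
  qed
  also have "\<dots> = (\<Sum>i=0..<l. alt_det l g (x(i := x i + 1)) + alt_det l g (x(i := x i - 1)))"
    unfolding alt_det_leibniz sum.distrib[symmetric] by (rule sum.swap)
  finally show ?thesis by (simp only: atLeast0LessThan)
qed

lemma alt_det_antisym: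
  assumes "Suc i < l"
  shows "alt_det l g (x \<circ> transpose i (Suc i)) = - alt_det l g x"
proof -
  let ?t = "transpose i (Suc i)" and ?A = "mat l l (\<lambda>(i, j). g j (x i))"
  have t: "?t permutes {0..<l}" using assms by (intro permutes_swap_id) auto
  have "mat l l (\<lambda>(i, j). g j ((x \<circ> ?t) i)) = mat l l (\<lambda>(i, j). ?A $$ (?t i, j))"
    using permutes_in_image[OF t] by (intro eq_matI) auto
  moreover have "det (mat l l (\<lambda>(i, j). ?A $$ (?t i, j))) = signof ?t * det ?A"
    by (rule det_permute_rows[OF _ t]) simp
  ultimately show ?thesis by (simp add: alt_det_def sign_swap_id)
qed

lemma alt_det_scale_row:
  assumes "i < l" "\<And>j. j < l \<Longrightarrow> g j a = c * g j (x i)"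
  shows "alt_det l g (x(i := a)) = c * alt_det l g x"
proof -
  have "(\<Prod>k=0..<l. g (p k) ((x(i := a)) k)) = c * (\<Prod>k=0..<l. g (p k) (x k))"
    if "p permutes {0..<l}" for p
  proof -
    have "p i < l" using permutes_in_image[OF that, of i] assms by auto
    hence "g (p i) a = c * g (p i) (x i)" by (rule assms)
    moreover have "(\<Prod>k\<in>{0..<l} - {i}. g (p k) ((x(i := a)) k)) = (\<Prod>k\<in>{0..<l} - {i}. g (p k) (x k))"
      by (intro prod.cong) auto
    ultimately show ?thesis using \<open>i < l\<close>
      by (simp add: prod.remove[of "{0..<l}" i] mult.assoc)
  qed
  thus ?thesis
    by (simp add: alt_det_leibniz sum_distrib_left mult.left_commute)
qed

lemma alt_det_nth_0:
  "fps_nth (alt_det l g x) 0 = alt_det l (\<lambda>j a. fps_nth (g j a) 0) x"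
proof -
  have "fps_nth (prod f A) 0 = (\<Prod>a\<in>A. fps_nth (f a) 0)" for f :: "nat \<Rightarrow> 'a fps" and A
    by (induction A rule: infinite_finite_induct) auto
  moreover have "fps_nth (signof p * f) 0 = signof p * fps_nth f 0" for p and f :: "'a fps"
    by (simp add: sign_def)
  ultimately show ?thesis by (simp add: alt_det_leibniz fps_sum_nth)
qed

text \<open>Distinct values in \<open>{1..l}\<close> exhaust it. Contrapositively, a point with
  coordinates in this range but at positive distance from \<open>rho\<close> has a repeated
  coordinate.\<close>

lemma sum_rho_inj:
  assumes "inj_on x {..<l}" "\<And>i. i < l \<Longrightarrow> 1 \<le> x i \<and> x i \<le> int l"
  shows "(\<Sum>i<l. x i) = (\<Sum>i<l. rho i)"
proof -
  have *: "(\<Sum>i<l. f i) = \<Sum> {1..int l}"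
    if "inj_on f {..<l}" "\<And>i. i < l \<Longrightarrow> 1 \<le> f i \<and> f i \<le> int l" for f
  proof -
    have "f ` {..<l} = {1..int l}"
      using that by (intro card_subset_eq) (auto simp: card_image)
    thus ?thesis using sum.reindex[OF that(1), of id] by simp
  qed
  show ?thesis using *[OF assms] *[of rho] by (simp add: rho_def inj_on_def)
qed

text \<open>Either some coordinate exceeds \<open>l\<close>, by at most \<open>M\<close>, and its
  row vanishes; or all lie in \<open>{1..l}\<close> and two rows coincide.\<close>

lemma alt_det_initial:
  assumes c: "\<And>j a. j < l \<Longrightarrow> int l < a \<Longrightarrow> a \<le> int l + int M \<Longrightarrow> c j a = 0"
    and x: "\<forall>i. rho i \<le> x i" "(\<Sum>i<l. x i - rho i) > 0" "(\<Sum>i<l. x i - rho i) \<le> int M"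
  shows "alt_det l c x = 0"
proof (cases "\<exists>i<l. x i > int l")
  case True
  then obtain i where i: "i < l" "x i > int l" by blast
  have "x i - rho i \<le> (\<Sum>i<l. x i - rho i)"
    using x(1) i by (intro member_le_sum) auto
  hence "x i \<le> int l + int M" using x(3) i by (simp add: rho_def)
  hence z: "c j (x i) = 0" if "j < l" for j using c that i by blast
  \<comment> \<open>The update changes nothing; row scaling with factor 0 expresses that row
    \<open>i\<close> is zero.\<close>
  hence "alt_det l c (x(i := x i)) = 0 * alt_det l c x"
    using i by (intro alt_det_scale_row) auto
  thus ?thesis by simp
next
  case False
  have bounds: "1 \<le> x i \<and> x i \<le> int l" if "i < l" for i
  proof
    show "1 \<le> x i" using x(1)[rule_format, of i] by (simp add: rho_def)
    show "x i \<le> int l" using False that by force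
  qed
  have "\<not> inj_on x {..<l}"
    using sum_rho_inj[of x l] bounds x(2) by (auto simp: sum_subtractf)
  then obtain i j where ij: "i < l" "j < l" "i \<noteq> j" "x i = x j" by (auto simp: inj_on_def)
  show ?thesis unfolding alt_det_def
    by (rule det_identical_rows[of _ l i j]) (use ij in \<open>auto intro!: eq_vecI\<close>)
qed

text \<open>The cofactors along column 0 do not see that column, so they may be computed with zeros
  in it.\<close>

lemma alt_det_expand_0:
  assumes "l > 0"
  shows "\<exists>C. \<forall>f. alt_det l (g(0 := f)) x = (\<Sum>i<l. f (x i) * C i)"
proof (intro exI allI)
  let ?A = "\<lambda>f. mat l l (\<lambda>(i, j). (g(0 := f)) j (x i))"
  fix f
  have "alt_det l (g(0 := f)) x = (\<Sum>i<l. ?A f $$ (i, 0) * cofactor (?A f) i 0)"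
    unfolding alt_det_def by (rule laplace_expansion_column) (use assms in auto)
  also have "\<dots> = (\<Sum>i<l. f (x i) * cofactor (?A (\<lambda>_. 0)) i 0)"
  proof (rule sum.cong)
    fix i assume i: "i \<in> {..<l}"
    have "mat_delete (?A f) i 0 = mat_delete (?A (\<lambda>_. 0)) i 0"
      by (intro eq_matI) (auto simp: mat_delete_def)
    thus "?A f $$ (i, 0) * cofactor (?A f) i 0 = f (x i) * cofactor (?A (\<lambda>_. 0)) i 0"
      using i assms by (simp add: cofactor_def)
  qed simp
  finally show "alt_det l (g(0 := f)) x = (\<Sum>i<l. f (x i) * cofactor (?A (\<lambda>_. 0)) i 0)" .
qed

lemma alt_det_linear_0:
  assumes "l > 0"
  shows "alt_det l (g(0 := \<lambda>a. \<Sum>q\<in>Q. c q * h q a)) x = (\<Sum>q\<in>Q. c q * alt_det l (g(0 := h q)) x)"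
proof -
  obtain C where C: "\<And>f. alt_det l (g(0 := f)) x = (\<Sum>i<l. f (x i) * C i)"
    using alt_det_expand_0[OF assms, of g x] by blast
  have "alt_det l (g(0 := \<lambda>a. \<Sum>q\<in>Q. c q * h q a)) x = (\<Sum>i<l. \<Sum>q\<in>Q. c q * (h q (x i) * C i))"
    unfolding C by (simp add: sum_distrib_right mult.assoc)
  also have "\<dots> = (\<Sum>q\<in>Q. c q * alt_det l (g(0 := h q)) x)"
    unfolding C sum_distrib_left by (rule sum.swap)
  finally show ?thesis .
qed

text \<open>As \<open>rho i - 1 = rho (i - 1)\<close>, the correction terms are row operations.\<close>

lemma alt_det_rho_unipotent:
  assumes "\<And>j. j < l \<Longrightarrow> g j 0 = 0"
  shows "alt_det l (\<lambda>j a. g j a - y * g j (a - 1)) rho = alt_det l g rho"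
proof -
  let ?L = "mat l l (\<lambda>(i, k). if k = i then 1 else if Suc k = i then - y else 0)"
  let ?K = "mat l l (\<lambda>(i, j). g j (rho i))"
  have "mat l l (\<lambda>(i, j). g j (rho i) - y * g j (rho i - 1)) = ?L * ?K"
  proof (rule eq_matI)
    fix i j assume "i < dim_row (?L * ?K)" "j < dim_col (?L * ?K)"
    hence ij: "i < l" "j < l" by auto
    have "(?L * ?K) $$ (i, j) = (\<Sum>k=0..<l. (if k = i then 1 else if Suc k = i then - y else 0) * g j (rho k))"
      using ij by (simp add: scalar_prod_def)
    also have "\<dots> = (\<Sum>k=0..<l. (if k = i then g j (rho k) else 0) +
        (if Suc k = i then - y * g j (rho k) else 0))"
      by (intro sum.cong) auto
    also have "\<dots> = g j (rho i) + (\<Sum>k=0..<l. if Suc k = i then - y * g j (rho k) else 0)"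
      using ij by (simp add: sum.distrib)
    also have "(\<Sum>k=0..<l. if Suc k = i then - y * g j (rho k) else 0) = - y * g j (rho i - 1)"
    proof (cases i)
      \<comment> \<open>Row 0 has no predecessor, but \<open>rho 0 - 1 = 0\<close>, where
        \<open>g j\<close> vanishes.\<close>
      case 0
      thus ?thesis using assms ij by (simp add: rho_def)
    next
      case (Suc k)
      thus ?thesis using ij by (simp add: rho_def add.commute)
    qed
    finally show "mat l l (\<lambda>(i, j). g j (rho i) - y * g j (rho i - 1)) $$ (i, j) = (?L * ?K) $$ (i, j)"
      using ij by simp
  qed auto
  moreover have "det (?L * ?K) = det ?L * det ?K" by (rule det_mult) auto
  moreover have "det ?L = 1"
  proof -
    have "det ?L = prod_list (diag_mat ?L)" by (rule det_lower_triangular[of l]) auto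
    also have "diag_mat ?L = replicate l 1"
      by (auto simp: diag_mat_def intro!: replicate_eqI)
    finally show ?thesis by simp
  qed
  ultimately show ?thesis by (simp add: alt_det_def)
qed

section \<open>The determinants for odd and for even \<open>m\<close>\<close>

lemma reflectable_odd:
  "reflectable l M y 0 (\<lambda>x. fps_exp y * alt_det l (\<lambda>j. kappa (int j + 1)) x)"
proof
  let ?g = "\<lambda>j::nat. kappa (int j + 1)"
  show "fps_deriv (fps_exp y * alt_det l ?g x) = fps_const y * (fps_exp y * alt_det l ?g x)
      + (\<Sum>i<l. fps_exp y * alt_det l ?g (x(i := x i + 1)) + fps_exp y * alt_det l ?g (x(i := x i - 1)))"
    for x
  \<comment> \<open>The exponential factor contributes the term with \<open>y\<close>, the
    determinant contributes the steps.\<close>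
  proof -
    have "fps_deriv (alt_det l ?g x) =
        (\<Sum>i<l. alt_det l ?g (x(i := x i + 1)) + alt_det l ?g (x(i := x i - 1)))"
      by (rule fps_deriv_alt_det) (rule fps_deriv_kappa)
    thus ?thesis by (simp add: sum_distrib_left distrib_left mult_ac add.commute del: fun_upd_apply)
  qed
  show "fps_exp y * alt_det l ?g (x \<circ> transpose i (Suc i)) = - (fps_exp y * alt_det l ?g x)"
    if "Suc i < l" for i x
    unfolding alt_det_antisym[OF that] by simp
  \<comment> \<open>Odd functions vanish at 0, so moving coordinate 0 there makes a zero
    row.\<close>
  show "fps_exp y * alt_det l ?g (x(0 := 0)) = fps_const 0 * (fps_exp y * alt_det l ?g x)"
    if "0 < l" for x
    by (subst alt_det_scale_row[where c = 0]) (use that in auto)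
  have "fps_nth (alt_det l ?g rho) 0 = alt_det l (\<lambda>j a. fps_nth (?g j a) 0) rho"
    by (rule alt_det_nth_0)
  also have "mat l l (\<lambda>(i, j). fps_nth (?g j (rho i)) 0) = 1\<^sub>m l"
    by (intro eq_matI) (auto simp: kappa_nth_0 rho_def)
  hence "alt_det l (\<lambda>j a. fps_nth (?g j a) 0) rho = 1"
    by (simp add: alt_det_def)
  finally show "fps_nth (fps_exp y * alt_det l ?g rho) 0 = 1" by simp
  show "fps_nth (fps_exp y * alt_det l ?g x) 0 = 0"
    if "\<forall>i. rho i \<le> x i" "0 < (\<Sum>i<l. x i - rho i)" "(\<Sum>i<l. x i - rho i) \<le> int M" for x
    using alt_det_initial[OF _ that, where c = "\<lambda>j a. fps_nth (?g j a) 0"]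
    by (simp add: alt_det_nth_0 kappa_nth_0)
qed simp

text \<open>By the symmetry of \<open>I_fps\<close>, column \<open>j\<close> taken at
  \<open>rho\<close> is row \<open>j + 1\<close> of the matrix in the theorem for \<open>p\<close>
  fixed points.\<close>

definition even_col :: "nat \<Rightarrow> nat \<Rightarrow> nat \<Rightarrow> int \<Rightarrow> rat fps" where
  "even_col l p j a = (if j = 0 then kappa (int l + int p) a else - kappa (int j) a)"

text \<open>Only column 0 depends on \<open>p\<close>, so weighting it by \<open>y ^ p\<close>
  collects the determinants for all \<open>p \<le> M\<close> into one.\<close>

definition even_cols :: "nat \<Rightarrow> nat \<Rightarrow> rat \<Rightarrow> nat \<Rightarrow> int \<Rightarrow> rat fps" where
  "even_cols l M y = (even_col l 0)(0 := \<lambda>a. \<Sum>p\<le>M. fps_const (y ^ p) * even_col l p 0 a)"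

lemma alt_det_even_cols:
  assumes "l > 0"
  shows "alt_det l (even_cols l M y) x = (\<Sum>p\<le>M. fps_const (y ^ p) * alt_det l (even_col l p) x)"
proof -
  have "(even_col l 0)(0 := even_col l p 0) = even_col l p" for p
    by (auto simp: even_col_def fun_eq_iff)
  thus ?thesis unfolding even_cols_def using assms by (simp add: alt_det_linear_0 del: fun_upd_apply)
qed

lemma even_cols_0 [simp]: "even_cols l M y j 0 = 0"
  by (simp add: even_cols_def even_col_def)

lemma even_cols_minus: "even_cols l M y j (- a) = - even_cols l M y j a"
  by (simp add: even_cols_def even_col_def kappa_minus sum_negf)

text \<open>At \<open>t = 0\<close> column 0 is a geometric sequence starting at
  \<open>a = l\<close>. Subtracting \<open>y\<close> times the preceding entry cancels it for
  \<open>l < a \<le> l + M\<close>; at the truncation point this stops.\<close>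

lemma even_cols_nth_0:
  assumes "a \<ge> 0" "l > 0"
  shows "fps_nth (even_cols l M y j a) 0 =
    (if j = 0 then (if int l \<le> a \<and> a \<le> int l + int M then y ^ nat (a - int l) else 0)
     else if a = int j then -1 else 0)"
proof (cases "j = 0")
  case True
  have "fps_nth (even_cols l M y j a) 0 = (\<Sum>p\<le>M. if a = int l + int p then y ^ p else 0)"
    using True assms
    by (auto simp: even_cols_def even_col_def fps_sum_nth kappa_nth_0 intro!: sum.cong)
  also have "\<dots> = (\<Sum>p\<le>M. if p = nat (a - int l) then (if int l \<le> a then y ^ p else 0) else 0)"
    by (intro sum.cong) auto
  finally show ?thesis using True by (auto simp: nat_le_iff)
qed (use assms in \<open>simp add: even_cols_def even_col_def kappa_nth_0\<close>)

text \<open>At \<open>t = 0\<close> the matrix is that of an \<open>l\<close>-cycle with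
  \<open>l - 1\<close> columns negated, and the two signs cancel.\<close>

lemma alt_det_even_cols_nth_0:
  assumes "l > 0"
  shows "fps_nth (alt_det l (even_cols l M y) rho) 0 = 1"
proof -
  let ?A = "mat l l (\<lambda>(i, j). if j = 0 then (if Suc i = l then 1 else 0) else if Suc i = j then -1 else 0 :: rat)"
  have "fps_nth (alt_det l (even_cols l M y) rho) 0 = det ?A"
    unfolding alt_det_nth_0 unfolding alt_det_def using assms
    by (intro arg_cong[of _ _ det] eq_matI) (auto simp: even_cols_nth_0 rho_def)
  also have "\<dots> = (\<Sum>i<l. ?A $$ (i, 0) * cofactor ?A i 0)"
    by (rule laplace_expansion_column) (use assms in auto)
  also have "\<dots> = (\<Sum>i<l. if i = l - 1 then cofactor ?A i 0 else 0)"
    using assms by (intro sum.cong) auto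
  also have "\<dots> = cofactor ?A (l - 1) 0" using assms by simp
  also have "mat_delete ?A (l - 1) 0 = (-1) \<cdot>\<^sub>m 1\<^sub>m (l - 1)"
    by (intro eq_matI) (auto simp: mat_delete_def)
  hence "cofactor ?A (l - 1) 0 = 1"
    by (simp add: cofactor_def power_add[symmetric] mult_2[symmetric] power_mult_distrib[symmetric])
  finally show ?thesis .
qed

text \<open>For \<open>h\<close> odd and \<open>g a = h a - y * h (a - 1)\<close>, one has
  \<open>g 0 = - y * h (- 1) = y * h 1 = y * g 1\<close>.\<close>

lemma reflectable_even:
  assumes "l > 0"
  shows "reflectable l M 0 y
    (alt_det l (\<lambda>j a. even_cols l M y j a - fps_const y * even_cols l M y j (a - 1)))"
proof
  let ?h = "even_cols l M y"
  let ?g = "\<lambda>j a. ?h j a - fps_const y * ?h j (a - 1)"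
  have h: "fps_deriv (?h j a) = ?h j (a + 1) + ?h j (a - 1)" for j a
    by (simp add: even_cols_def even_col_def fps_deriv_sum fps_deriv_kappa sum.distrib distrib_left)
  have "fps_deriv (?g j a) = ?g j (a + 1) + ?g j (a - 1)" for j a
    by (simp add: h algebra_simps)
  thus "fps_deriv (alt_det l ?g x) = fps_const 0 * alt_det l ?g x
      + (\<Sum>i<l. alt_det l ?g (x(i := x i + 1)) + alt_det l ?g (x(i := x i - 1)))" for x
    by (subst fps_deriv_alt_det) auto
  show "alt_det l ?g (x \<circ> transpose i (Suc i)) = - alt_det l ?g x" if "Suc i < l" for i x
    by (rule alt_det_antisym[OF that])
  show "alt_det l ?g (x(0 := 0)) = fps_const y * alt_det l ?g x" if "0 < l" "x 0 = 1" for x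
    using that even_cols_minus[of l M y _ 1] by (intro alt_det_scale_row) auto
  \<comment> \<open>At \<open>rho\<close> the correction terms disappear by row operations.\<close>
  show "fps_nth (alt_det l ?g rho) 0 = 1"
    using alt_det_even_cols_nth_0[OF assms] by (simp add: alt_det_rho_unipotent)
  have g0: "fps_nth (?g j a) 0 = 0" if "j < l" "int l < a" "a \<le> int l + int M" for j a
  proof -
    have "nat (a - int l) = Suc (nat (a - 1 - int l))" using that by auto
    thus ?thesis using that by (simp add: even_cols_nth_0)
  qed
  show "fps_nth (alt_det l ?g x) 0 = 0"
    if "\<forall>i. rho i \<le> x i" "0 < (\<Sum>i<l. x i - rho i)" "(\<Sum>i<l. x i - rho i) \<le> int M" for x
    unfolding alt_det_nth_0 using g0 by (intro alt_det_initial[OF _ that]) blast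
qed (use assms in simp)

lemma completions_odd:
  "fact n * fps_nth (fps_exp y * det1 l (\<lambda>i j. I_fps (i - j) - I_fps (i + j))) n = completions l y 0 n []"
proof -
  interpret reflectable l n y 0 "\<lambda>x. fps_exp y * alt_det l (\<lambda>j. kappa (int j + 1)) x"
    by (rule reflectable_odd)
  have "det1 l (\<lambda>i j. I_fps (i - j) - I_fps (i + j)) = alt_det l (\<lambda>j. kappa (int j + 1)) rho"
    unfolding det1_def alt_det_def by (intro arg_cong[of _ _ det] eq_matI) (auto simp: kappa_def rho_def)
  thus ?thesis using shift_sums_eq_completions[of "[]" n] by simp
qed

text \<open>At \<open>rho\<close> row operations remove the correction terms, and linearity in
  column 0 then yields the generating function over \<open>p\<close>.\<close>

lemma completions_even:
  assumes "l > 0" "n \<le> M"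
  shows "fact n * fps_nth (\<Sum>p\<le>M. fps_const (y ^ p) *
      det1 l (\<lambda>i j. if i = 1 then I_fps (int p + int l - j) - I_fps (int p + int l + j)
                        else I_fps (i + j - 1) - I_fps (i - j - 1))) n = completions l 0 y n []"
proof -
  interpret reflectable l M 0 y
    "alt_det l (\<lambda>j a. even_cols l M y j a - fps_const y * even_cols l M y j (a - 1))"
    by (rule reflectable_even[OF assms(1)])
  have "det1 l (\<lambda>i j. if i = 1 then I_fps (int p + int l - j) - I_fps (int p + int l + j)
      else I_fps (i + j - 1) - I_fps (i - j - 1)) = alt_det l (even_col l p) rho" for p
  proof -
    let ?B = "mat l l (\<lambda>(i, j). even_col l p j (rho i))"
    have entry: "I_fps (int p + int l - int (Suc c)) = I_fps (int (Suc c) - (int l + int p))"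
      "I_fps (int r - int c - 1) = I_fps (1 + int c - int r)" for r c
      using I_fps_minus[of "int (Suc c) - (int l + int p)"] I_fps_minus[of "int (Suc c) - int r"]
      by (simp_all add: algebra_simps)
    have "det1 l (\<lambda>i j. if i = 1 then I_fps (int p + int l - j) - I_fps (int p + int l + j)
        else I_fps (i + j - 1) - I_fps (i - j - 1)) = det (transpose_mat ?B)"
      unfolding det1_def
      using entry by (intro arg_cong[of _ _ det] eq_matI) (auto simp: even_col_def kappa_def rho_def add_ac)
    also have "\<dots> = det ?B" by (rule det_transpose[of _ l]) simp
    finally show ?thesis by (simp add: alt_det_def)
  qed
  moreover have "alt_det l (\<lambda>j a. even_cols l M y j a - fps_const y * even_cols l M y j (a - 1)) rho
      = (\<Sum>p\<le>M. fps_const (y ^ p) * alt_det l (even_col l p) rho)"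
    using assms by (simp add: alt_det_rho_unipotent alt_det_even_cols)
  ultimately show ?thesis using shift_sums_eq_completions[of "[]" n] assms by simp
qed

section \<open>Involutions\<close>

text \<open>A labelling bounds from above the rank of every arc at the moment when it is closed, so its
  existence says that no arc of rank \<open>l\<close> is closed. The parameter \<open>c\<close> is 0 for odd and 1 for
  even \<open>m\<close>, that is, \<open>m + c = 2 * l + 1\<close>.\<close>

definition labelling :: "nat \<Rightarrow> nat \<Rightarrow> nat set \<Rightarrow> (nat \<Rightarrow> nat) \<Rightarrow> (nat \<Rightarrow> nat) \<Rightarrow> bool" where
  "labelling l c U \<tau> h \<longleftrightarrow> (\<forall>a\<in>U. a < \<tau> a \<longrightarrow> h a < l) \<and>
     (\<forall>a\<in>U. \<forall>a'\<in>U. a < a' \<and> a' < \<tau> a' \<and> \<tau> a' < \<tau> a \<longrightarrow> h a' < h a) \<and>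
     (\<forall>a\<in>U. \<forall>b\<in>U. a < b \<and> b < \<tau> a \<and> \<tau> b = b \<longrightarrow> c \<le> h a)"

text \<open>A state of the scan: \<open>A\<close> holds the left ends of open arcs, \<open>B\<close>
  the unread positions, and \<open>r\<close> the ranks reached so far, as lower bounds for the
  labels. Points already dealt with are dropped.\<close>

definition ranked_involutions ::
    "nat \<Rightarrow> nat \<Rightarrow> nat set \<Rightarrow> (nat \<Rightarrow> nat) \<Rightarrow> nat set \<Rightarrow> (nat \<Rightarrow> nat) set" where
  "ranked_involutions l c A r B = {\<tau>. \<tau> permutes (A \<union> B) \<and> \<tau> \<circ> \<tau> = id \<and> \<tau> ` A \<subseteq> B \<and>
     (\<exists>h. labelling l c (A \<union> B) \<tau> h \<and> (\<forall>a\<in>A. r a \<le> h a))}"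

section \<open>Reading the next position of an involution\<close>

lemma ranked_involutions_fixed:
  assumes "b \<in> B" "\<And>x. x \<in> B \<Longrightarrow> b \<le> x" "\<And>a x. a \<in> A \<Longrightarrow> x \<in> B \<Longrightarrow> a < x"
  shows "{\<tau> \<in> ranked_involutions l c A r B. \<tau> b = b} =
    ranked_involutions l c A (\<lambda>a. max c (r a)) (B - {b})"
proof (intro equalityI subsetI)
  fix \<tau> assume "\<tau> \<in> {\<tau> \<in> ranked_involutions l c A r B. \<tau> b = b}"
  then obtain h where p: "\<tau> permutes (A \<union> B)" and inv: "\<tau> \<circ> \<tau> = id" and AB: "\<tau> ` A \<subseteq> B"
    and lab: "labelling l c (A \<union> B) \<tau> h" and r: "\<forall>a\<in>A. r a \<le> h a" and b: "\<tau> b = b"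
    by (auto simp: ranked_involutions_def)
  have "\<tau> permutes (A \<union> (B - {b}))" using p by (rule permutes_superset) (use b in auto)
  moreover have AB': "\<tau> ` A \<subseteq> B - {b}"
    using AB b assms(1,3) permutes_inj[OF p] by (fastforce dest: injD)
  moreover have "labelling l c (A \<union> (B - {b})) \<tau> h" using lab unfolding labelling_def by blast
  moreover have "max c (r a) \<le> h a" if "a \<in> A" for a
  proof -
    \<comment> \<open>Every open arc begins before \<open>b\<close> and ends after it, so it
      encloses the fixed point.\<close>
    have "\<tau> a \<in> B - {b}" using AB' that by blast
    hence "b < \<tau> a" using assms(2)[of "\<tau> a"] by force
    moreover have "a < b" using assms that by blast
    ultimately have "c \<le> h a" using lab b that assms(1) unfolding labelling_def by blast
    thus ?thesis using r that by simp
  qed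
  ultimately show "\<tau> \<in> ranked_involutions l c A (\<lambda>a. max c (r a)) (B - {b})"
    using inv unfolding ranked_involutions_def by blast
next
  fix \<tau> assume "\<tau> \<in> ranked_involutions l c A (\<lambda>a. max c (r a)) (B - {b})"
  then obtain h where p: "\<tau> permutes (A \<union> (B - {b}))" and inv: "\<tau> \<circ> \<tau> = id" and AB: "\<tau> ` A \<subseteq> B - {b}"
    and lab: "labelling l c (A \<union> (B - {b})) \<tau> h" and r: "\<forall>a\<in>A. max c (r a) \<le> h a"
    by (auto simp: ranked_involutions_def)
  have "b \<notin> A" using assms by blast
  hence b: "\<tau> b = b" using permutes_not_in[OF p] by auto
  have "\<tau> permutes (A \<union> B)" using p by (rule permutes_subset) auto
  moreover have "labelling l c (A \<union> B) \<tau> h"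
    unfolding labelling_def
  proof (intro conjI ballI impI)
    fix a assume "a \<in> A \<union> B" "a < \<tau> a"
    thus "h a < l" using b lab by (cases "a = b") (auto simp: labelling_def)
  next
    fix a a' assume "a \<in> A \<union> B" "a' \<in> A \<union> B" "a < a' \<and> a' < \<tau> a' \<and> \<tau> a' < \<tau> a"
    moreover from this have "a \<noteq> b" "a' \<noteq> b" using b by auto
    ultimately show "h a' < h a" using lab unfolding labelling_def by blast
  next
    fix a x assume a: "a \<in> A \<union> B" "x \<in> A \<union> B" "a < x \<and> x < \<tau> a \<and> \<tau> x = x"
    hence "a \<noteq> b" using b by auto
    show "c \<le> h a"
    proof (cases "x = b")
      case True
      hence "a \<in> A" using a assms(2)[of a] by auto
      thus ?thesis using r by simp
    next
      case False
      thus ?thesis using lab a \<open>a \<noteq> b\<close> unfolding labelling_def by blast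
    qed
  qed
  ultimately show "\<tau> \<in> {\<tau> \<in> ranked_involutions l c A r B. \<tau> b = b}"
    using inv AB r b unfolding ranked_involutions_def by auto
qed

text \<open>Rank 0 imposes no bound on the label of the new arc, so \<open>b\<close> merely moves
  from \<open>B\<close> to \<open>A\<close>.\<close>

lemma ranked_involutions_open:
  assumes "b \<in> B" "\<And>x. x \<in> B \<Longrightarrow> b \<le> x" "\<And>a x. a \<in> A \<Longrightarrow> x \<in> B \<Longrightarrow> a < x"
  shows "{\<tau> \<in> ranked_involutions l c A r B. \<tau> b \<in> B - {b}} =
    ranked_involutions l c (insert b A) (r(b := 0)) (B - {b})"
proof -
  have U: "insert b A \<union> (B - {b}) = A \<union> B" using assms(1) by auto
  have bA: "b \<notin> A" using assms by blast
  have "\<tau> ` A \<subseteq> B \<and> \<tau> b \<in> B - {b} \<longleftrightarrow> \<tau> ` insert b A \<subseteq> B - {b}" if inv: "\<tau> \<circ> \<tau> = id" for \<tau>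
  proof -
    have "\<tau> a \<noteq> b" if "a \<in> A" "\<tau> b \<in> B - {b}" for a
      using fun_cong[OF inv, of a] that assms(3)[of a "\<tau> b"] by auto
    thus ?thesis by auto
  qed
  moreover have "(\<forall>a\<in>insert b A. (r(b := 0)) a \<le> h a) \<longleftrightarrow> (\<forall>a\<in>A. r a \<le> h a)" for h :: "nat \<Rightarrow> nat"
    using bA by auto
  ultimately show ?thesis unfolding ranked_involutions_def U by blast
qed

definition close_ranks :: "nat \<Rightarrow> (nat \<Rightarrow> nat) \<Rightarrow> nat \<Rightarrow> nat" where
  "close_ranks a r x = (if x < a then max (Suc (r a)) (r x) else r x)"

text \<open>All other open arcs end after \<open>b\<close>, so those opened before \<open>a\<close>
  enclose the arc from \<open>a\<close> to \<open>b\<close> and need larger labels.\<close>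

lemma labelling_close:
  assumes b: "b \<in> B" "\<And>x. x \<in> B \<Longrightarrow> b \<le> x" "\<And>a x. a \<in> A \<Longrightarrow> x \<in> B \<Longrightarrow> a < x"
    and a: "a \<in> A" "\<tau> a = b" "\<tau> b = a" "\<tau> ` A \<subseteq> B" "inj \<tau>"
    and \<sigma>: "\<And>x. x \<in> A \<union> B - {a, b} \<Longrightarrow> \<sigma> x = \<tau> x"
  shows "(\<exists>h. labelling l c (A \<union> B) \<tau> h \<and> (\<forall>x\<in>A. r x \<le> h x)) \<longleftrightarrow>
    r a < l \<and> (\<exists>h. labelling l c ((A - {a}) \<union> (B - {b})) \<sigma> h \<and> (\<forall>x\<in>A - {a}. close_ranks a r x \<le> h x))"
    (is "?lhs \<longleftrightarrow> ?rhs")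
proof -
  have ab: "a < b" "b \<notin> A" "a \<notin> B" using a b by blast+
  have U: "(A - {a}) \<union> (B - {b}) = A \<union> B - {a, b}" using ab by auto
  have outer: "b < \<tau> x" if "x \<in> A" "x \<noteq> a" for x
  proof -
    have "\<tau> x \<noteq> b" using injD[OF a(5), of x a] a(2) that by auto
    thus ?thesis using b(2)[of "\<tau> x"] a(4) that by force
  qed
  have lab_\<sigma>: "labelling l c ((A - {a}) \<union> (B - {b})) \<sigma> h \<longleftrightarrow> labelling l c (A \<union> B - {a, b}) \<tau> h" for h
    unfolding U labelling_def using \<sigma> by simp
  show ?thesis
  proof
    assume ?lhs
    then obtain h where h: "labelling l c (A \<union> B) \<tau> h" "\<forall>x\<in>A. r x \<le> h x" by blast
    have "h a < l" using h(1) a ab unfolding labelling_def by auto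
    moreover have "r a \<le> h a" using h a by blast
    moreover have "labelling l c (A \<union> B - {a, b}) \<tau> h"
      using h(1) unfolding labelling_def by blast
    moreover have "close_ranks a r x \<le> h x" if "x \<in> A - {a}" for x
    proof (cases "x < a")
      case True
      have "\<tau> a < \<tau> x" using outer that a by auto
      hence "h a < h x" using h(1) True that a ab unfolding labelling_def by blast
      thus ?thesis using h(2) that \<open>r a \<le> h a\<close> by (auto simp: close_ranks_def)
    qed (use h that in \<open>auto simp: close_ranks_def\<close>)
    ultimately show ?rhs unfolding lab_\<sigma> by (intro conjI exI[of _ h]) auto
  next
    assume ?rhs
    then obtain h where ra: "r a < l" and h: "labelling l c (A \<union> B - {a, b}) \<tau> h"
      "\<forall>x\<in>A - {a}. close_ranks a r x \<le> h x" unfolding lab_\<sigma> by blast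
    \<comment> \<open>The least admissible label for \<open>a\<close> suffices: \<open>b\<close> is
      the first unread position, so no remaining arc or fixed point lies inside the arc from
      \<open>a\<close> to \<open>b\<close>.\<close>
    have "labelling l c (A \<union> B) \<tau> (h(a := r a))"
      unfolding labelling_def
    proof (intro conjI ballI impI)
      fix x assume "x \<in> A \<union> B" "x < \<tau> x"
      moreover from this have "x \<noteq> b" using a ab by auto
      ultimately show "(h(a := r a)) x < l" using h(1) ra unfolding labelling_def by auto
    next
      fix x x' assume x: "x \<in> A \<union> B" "x' \<in> A \<union> B" "x < x' \<and> x' < \<tau> x' \<and> \<tau> x' < \<tau> x"
      hence "x' \<noteq> b" "x \<noteq> b" using a ab by auto
      have "x \<noteq> a"
      proof
        assume "x = a"
        hence "\<tau> x' < b" using x a by auto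
        hence "x' \<notin> B" "\<tau> x' \<notin> B" using b(2)[of "x'"] b(2)[of "\<tau> x'"] x by auto
        thus False using x a(4) by auto
      qed
      show "(h(a := r a)) x' < (h(a := r a)) x"
      proof (cases "x' = a")
        case True
        hence "x \<notin> B" using x ab b(2)[of x] by auto
        hence "x \<in> A - {a}" using x \<open>x \<noteq> a\<close> by auto
        hence "close_ranks a r x \<le> h x" using h by blast
        thus ?thesis using True x \<open>x \<noteq> a\<close> by (auto simp: close_ranks_def)
      next
        case False
        hence "h x' < h x"
          using h(1) x \<open>x' \<noteq> b\<close> \<open>x \<noteq> b\<close> \<open>x \<noteq> a\<close> unfolding labelling_def by blast
        thus ?thesis using False \<open>x \<noteq> a\<close> by simp
      qed
    next
      fix x y assume x: "x \<in> A \<union> B" "y \<in> A \<union> B" "x < y \<and> y < \<tau> x \<and> \<tau> y = y"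
      have "y \<notin> {a, b}" "x \<noteq> b" using x a ab by auto
      have "x \<noteq> a"
      proof
        assume "x = a"
        hence "y < b" using x a by auto
        hence "y \<notin> B" using b(2)[of y] by auto
        hence "y \<in> A" using x by auto
        thus False using x a(4) \<open>y \<notin> B\<close> by auto
      qed
      thus "c \<le> (h(a := r a)) x"
        using h(1) x \<open>y \<notin> {a, b}\<close> \<open>x \<noteq> b\<close> unfolding labelling_def by auto
    qed
    moreover have "r x \<le> (h(a := r a)) x" if "x \<in> A" for x
      using h(2) that by (auto simp: close_ranks_def split: if_splits)
    ultimately show ?lhs by blast
  qed
qed

text \<open>Composing with the transposition removes the 2-cycle of \<open>a\<close> and
  \<open>b\<close> or puts it back, so this map is its own inverse.\<close>

lemma bij_betw_close:
  assumes b: "b \<in> B" "\<And>x. x \<in> B \<Longrightarrow> b \<le> x" "\<And>a x. a \<in> A \<Longrightarrow> x \<in> B \<Longrightarrow> a < x"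
    and a: "a \<in> A" "r a < l"
  shows "bij_betw (\<lambda>\<sigma>. \<sigma> \<circ> transpose a b)
    (ranked_involutions l c (A - {a}) (close_ranks a r) (B - {b}))
    {\<tau> \<in> ranked_involutions l c A r B. \<tau> b = a}"
proof (rule bij_betw_byWitness[where f' = "\<lambda>\<tau>. \<tau> \<circ> transpose a b"])
  let ?t = "transpose a b" and ?U = "A \<union> B - {a, b}"
  have ab: "a < b" "b \<notin> A" "a \<notin> B" using a b by blast+
  have U: "(A - {a}) \<union> (B - {b}) = ?U" using ab by auto
  have t: "?t permutes (A \<union> B)" using a b by (intro permutes_swap_id) auto
  show "(\<lambda>\<sigma>. \<sigma> \<circ> ?t) ` ranked_involutions l c (A - {a}) (close_ranks a r) (B - {b})
      \<subseteq> {\<tau> \<in> ranked_involutions l c A r B. \<tau> b = a}"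
  proof (rule image_subsetI)
    fix \<sigma> assume \<sigma>: "\<sigma> \<in> ranked_involutions l c (A - {a}) (close_ranks a r) (B - {b})"
    let ?\<tau> = "\<sigma> \<circ> ?t"
    have p: "\<sigma> permutes ?U" and inv: "\<sigma> (\<sigma> x) = x" and AB: "\<sigma> ` (A - {a}) \<subseteq> B - {b}" for x
      using \<sigma> unfolding ranked_involutions_def U by (auto simp: fun_eq_iff)
    have \<sigma>ab: "\<sigma> a = a" "\<sigma> b = b" using permutes_not_in[OF p] by auto
    have neq: "\<sigma> x \<noteq> a" "\<sigma> x \<noteq> b" if "x \<noteq> a" "x \<noteq> b" for x
      using that inv[of x] \<sigma>ab by metis+
    have p\<tau>: "?\<tau> permutes (A \<union> B)"
      using permutes_compose[OF t permutes_subset[OF p]] by auto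
    moreover have "?\<tau> \<circ> ?\<tau> = id"
    proof
      fix x show "(?\<tau> \<circ> ?\<tau>) x = id x"
        using \<sigma>ab inv neq by (cases "x = a"; cases "x = b") auto
    qed
    moreover have A\<tau>: "?\<tau> ` A \<subseteq> B"
    proof (rule image_subsetI)
      fix x assume "x \<in> A"
      thus "?\<tau> x \<in> B" using AB \<sigma>ab b ab by (cases "x = a") (auto simp: transpose_def)
    qed
    moreover have "\<exists>h. labelling l c (A \<union> B) ?\<tau> h \<and> (\<forall>x\<in>A. r x \<le> h x)"
    proof (rule iffD2[OF labelling_close[where \<tau> = ?\<tau> and \<sigma> = \<sigma>, OF b a(1)]])
      show "r a < l \<and> (\<exists>h. labelling l c (A - {a} \<union> (B - {b})) \<sigma> h \<and> (\<forall>x\<in>A - {a}. close_ranks a r x \<le> h x))"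
        using a(2) \<sigma> unfolding ranked_involutions_def by blast
      show "?\<tau> ` A \<subseteq> B" by (rule A\<tau>)
      show "inj ?\<tau>" by (rule permutes_inj[OF p\<tau>])
    qed (use \<sigma>ab in auto)
    ultimately show "?\<tau> \<in> {\<tau> \<in> ranked_involutions l c A r B. \<tau> b = a}"
      using \<sigma>ab unfolding ranked_involutions_def by simp
  qed
  show "(\<lambda>\<tau>. \<tau> \<circ> ?t) ` {\<tau> \<in> ranked_involutions l c A r B. \<tau> b = a}
      \<subseteq> ranked_involutions l c (A - {a}) (close_ranks a r) (B - {b})"
  proof (rule image_subsetI)
    fix \<tau> assume "\<tau> \<in> {\<tau> \<in> ranked_involutions l c A r B. \<tau> b = a}"
    hence \<tau>: "\<tau> \<in> ranked_involutions l c A r B" and \<tau>b: "\<tau> b = a" by auto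
    let ?\<sigma> = "\<tau> \<circ> ?t"
    have p: "\<tau> permutes (A \<union> B)" and inv: "\<tau> (\<tau> x) = x" and AB: "\<tau> ` A \<subseteq> B" for x
      using \<tau> unfolding ranked_involutions_def by (auto simp: fun_eq_iff)
    have \<tau>a: "\<tau> a = b" using inv[of b] \<tau>b by simp
    have neq: "\<tau> x \<noteq> a" "\<tau> x \<noteq> b" if "x \<noteq> a" "x \<noteq> b" for x
      using that inv[of x] \<tau>a \<tau>b by metis+
    have p\<sigma>: "?\<sigma> permutes ?U"
    proof (rule permutes_superset[OF permutes_compose[OF t p]])
      fix x assume "x \<in> A \<union> B - ?U"
      thus "?\<sigma> x = x" using \<tau>a \<tau>b by auto
    qed
    moreover have "?\<sigma> \<circ> ?\<sigma> = id"
    proof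
      fix x show "(?\<sigma> \<circ> ?\<sigma>) x = id x"
        using \<tau>a \<tau>b inv neq by (cases "x = a"; cases "x = b") auto
    qed
    moreover have "?\<sigma> ` (A - {a}) \<subseteq> B - {b}"
    proof (rule image_subsetI)
      fix x assume "x \<in> A - {a}"
      thus "?\<sigma> x \<in> B - {b}" using AB neq[of x] ab by (auto simp: transpose_def)
    qed
    moreover have "\<exists>h. labelling l c ((A - {a}) \<union> (B - {b})) ?\<sigma> h \<and>
        (\<forall>x\<in>A - {a}. close_ranks a r x \<le> h x)"
    proof (rule conjunct2[OF iffD1[OF labelling_close[where \<tau> = \<tau> and \<sigma> = ?\<sigma>, OF b a(1)]]])
      show "\<exists>h. labelling l c (A \<union> B) \<tau> h \<and> (\<forall>x\<in>A. r x \<le> h x)"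
        using \<tau> unfolding ranked_involutions_def by blast
      show "inj \<tau>" by (rule permutes_inj[OF p])
      show "\<tau> ` A \<subseteq> B" by (rule AB)
      show "\<tau> a = b" "\<tau> b = a" by (rule \<tau>a, rule \<tau>b)
    qed auto
    ultimately show "?\<sigma> \<in> ranked_involutions l c (A - {a}) (close_ranks a r) (B - {b})"
      unfolding ranked_involutions_def U by blast
  qed
qed (auto simp: fun_eq_iff)

lemma ranked_involutions_dead:
  assumes b: "b \<in> B" "\<And>x. x \<in> B \<Longrightarrow> b \<le> x" "\<And>a x. a \<in> A \<Longrightarrow> x \<in> B \<Longrightarrow> a < x"
    and a: "a \<in> A" "\<not> r a < l"
  shows "{\<tau> \<in> ranked_involutions l c A r B. \<tau> b = a} = {}"
proof -
  have False if \<tau>: "\<tau> \<in> ranked_involutions l c A r B" "\<tau> b = a" for \<tau>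
  proof -
    from \<tau> obtain h where h: "labelling l c (A \<union> B) \<tau> h" "\<forall>a\<in>A. r a \<le> h a"
      and inv: "\<tau> \<circ> \<tau> = id" by (auto simp: ranked_involutions_def)
    have "\<tau> a = b" using fun_cong[OF inv, of b] \<tau> by simp
    hence "h a < l" using h(1) a b unfolding labelling_def by auto
    thus False using h(2) a by fastforce
  qed
  thus ?thesis by blast
qed

lemma finite_ranked_involutions:
  "finite A \<Longrightarrow> finite B \<Longrightarrow> finite (ranked_involutions l c A r B)"
  by (rule finite_subset[OF _ finite_permutations[of "A \<union> B"]]) (auto simp: ranked_involutions_def)

text \<open>In the sorted list of left ends, being opened before an arc means having a smaller
  index.\<close>

lemma sorted_list_of_set_close:
  assumes "finite A" "s < card A"
  defines "as \<equiv> sorted_list_of_set A"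
  shows "map (close_ranks (as ! s) r) (sorted_list_of_set (A - {as ! s})) = close_arc s (map r as)"
proof -
  have s: "s < length as" and d: "distinct as" and srt: "sorted as" and set: "set as = A"
    using assms by (auto simp: as_def)
  have as: "as = take s as @ as ! s # drop (Suc s) as" using s by (rule id_take_nth_drop)
  have sw: "sorted_wrt (<) as" using srt d by (simp add: strict_sorted_iff)
  have sw': "sorted_wrt (<) (take s as @ as ! s # drop (Suc s) as)" using sw as by simp
  have "sorted_wrt (<) (take s as @ drop (Suc s) as)" and set': "set (take s as @ drop (Suc s) as) = A - {as ! s}"
  proof -
    show "sorted_wrt (<) (take s as @ drop (Suc s) as)"
      using sw' by (auto simp: sorted_wrt_append simp del: append_take_drop_id)
    have "A = set (take s as @ as ! s # drop (Suc s) as)" using as set by simp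
    moreover have "as ! s \<notin> set (take s as @ drop (Suc s) as)"
      using sw' by (auto simp: sorted_wrt_append simp del: append_take_drop_id)
    ultimately show "set (take s as @ drop (Suc s) as) = A - {as ! s}" by auto
  qed
  hence "sorted_list_of_set (A - {as ! s}) = take s as @ drop (Suc s) as"
    using sorted_list_of_set.idem_if_sorted_distinct[of "take s as @ drop (Suc s) as"]
    by (simp add: strict_sorted_iff)
  moreover have "map (close_ranks (as ! s) r) (take s as) = map (max (Suc (r (as ! s)))) (map r (take s as))"
    using sw' by (auto simp: close_ranks_def sorted_wrt_append simp del: append_take_drop_id)
  moreover have "map (close_ranks (as ! s) r) (drop (Suc s) as) = map r (drop (Suc s) as)"
    using sw' by (auto simp: close_ranks_def sorted_wrt_append simp del: append_take_drop_id)
  ultimately show ?thesis using s by (simp add: close_arc_def take_map drop_map)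
qed

text \<open>The first unread position is a fixed point, opens an arc, or closes one of the open
  arcs; these cases match the recursion of \<open>completions\<close>.\<close>

lemma sum_ranked_involutions:
  fixes y :: rat
  assumes "finite A" "finite B" "\<And>a x. a \<in> A \<Longrightarrow> x \<in> B \<Longrightarrow> a < x" "c \<le> 1"
  shows "(\<Sum>\<tau>\<in>ranked_involutions l c A r B. y ^ card {i \<in> B. \<tau> i = i}) =
    completions l (if c = 0 then y else 0) (if c = 0 then 0 else y) (card B) (map r (sorted_list_of_set A))"
  using assms(1-3)
proof (induction "card B" arbitrary: A B r)
  case 0
  hence B: "B = {}" by simp
  show ?case
  proof (cases "A = {}")
    case True
    have "ranked_involutions l c A r B = {id}"
      using True B by (auto simp: ranked_involutions_def labelling_def)
    thus ?thesis using True B by simp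
  next
    case False
    hence "ranked_involutions l c A r B = {}" using B by (auto simp: ranked_involutions_def)
    thus ?thesis using False B 0 by simp
  qed
next
  case (Suc n)
  let ?C = "completions l (if c = 0 then y else 0) (if c = 0 then 0 else y)"
  let ?R = "ranked_involutions l c"
  let ?w = "\<lambda>B \<tau>. y ^ card {i \<in> B. \<tau> i = i}"
  define b where "b = Min B"
  have "B \<noteq> {}" using Suc by auto
  hence b: "b \<in> B" "\<And>x. x \<in> B \<Longrightarrow> b \<le> x" using Suc.prems by (auto simp: b_def)
  note b3 = b Suc.prems(3)
  have n: "n = card (B - {b})" and finB: "finite (B - {b})" using Suc b by auto
  have finR: "finite (?R A r B)" using Suc.prems by (intro finite_ranked_involutions)
  let ?as = "sorted_list_of_set A"
  have split: "?R A r B = {\<tau> \<in> ?R A r B. \<tau> b = b} \<union> {\<tau> \<in> ?R A r B. \<tau> b \<in> B - {b}}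
      \<union> (\<Union>a\<in>A. {\<tau> \<in> ?R A r B. \<tau> b = a})" (is "_ = ?R1 \<union> ?R2 \<union> ?R3")
    using b permutes_in_image by (fastforce simp: ranked_involutions_def)
  have "(\<Sum>\<tau>\<in>?R A r B. ?w B \<tau>) = (\<Sum>\<tau>\<in>?R1. ?w B \<tau>) + (\<Sum>\<tau>\<in>?R2. ?w B \<tau>) + (\<Sum>\<tau>\<in>?R3. ?w B \<tau>)"
  proof -
    have "?R1 \<inter> ?R2 = {}" by auto
    moreover have "(?R1 \<union> ?R2) \<inter> ?R3 = {}" using b Suc.prems(3) by force
    moreover have "finite ?R1" "finite ?R2" "finite ?R3" using finR Suc.prems by auto
    ultimately show ?thesis by (subst split) (simp add: sum.union_disjoint)
  qed
  also have "(\<Sum>\<tau>\<in>?R1. ?w B \<tau>) = (\<Sum>\<tau>\<in>?R1. y * ?w (B - {b}) \<tau>)"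
  proof (intro sum.cong refl)
    fix \<tau> assume "\<tau> \<in> ?R1"
    hence "{i \<in> B. \<tau> i = i} = insert b {i \<in> B - {b}. \<tau> i = i}" using b by auto
    thus "?w B \<tau> = y * ?w (B - {b}) \<tau>" using finB by simp
  qed
  also have "\<dots> = y * ?C n (map (max c) (map r ?as))"
  proof -
    have R1: "?R1 = ?R A (\<lambda>a. max c (r a)) (B - {b})"
      by (rule ranked_involutions_fixed[OF b3])
    have "(\<Sum>\<tau>\<in>?R A (\<lambda>a. max c (r a)) (B - {b}). ?w (B - {b}) \<tau>)
        = ?C (card (B - {b})) (map (\<lambda>a. max c (r a)) ?as)"
      by (rule Suc.hyps(1)) (use n finB Suc.prems in auto)
    moreover have "map (\<lambda>a. max c (r a)) ?as = map (max c) (map r ?as)" by simp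
    ultimately show ?thesis unfolding R1 sum_distrib_left[symmetric] n[symmetric] by (simp only:)
  qed
  also have "(\<Sum>\<tau>\<in>?R2. ?w B \<tau>) = (\<Sum>\<tau>\<in>?R2. ?w (B - {b}) \<tau>)"
  proof (intro sum.cong refl)
    fix \<tau> assume "\<tau> \<in> ?R2"
    hence "{i \<in> B. \<tau> i = i} = {i \<in> B - {b}. \<tau> i = i}" by auto
    thus "?w B \<tau> = ?w (B - {b}) \<tau>" by simp
  qed
  also have "\<dots> = ?C n (map r ?as @ [0])"
  proof -
    have bA: "b \<notin> A" using b3 by blast
    have "sorted_list_of_set (insert b A) = ?as @ [b]"
    proof -
      have "sorted_wrt (<) (?as @ [b])"
        using Suc.prems b by (auto simp: sorted_wrt_append)
      hence "sorted (?as @ [b])" "distinct (?as @ [b])" by (simp_all only: strict_sorted_iff)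
      moreover have "set (?as @ [b]) = insert b A" using Suc.prems by auto
      ultimately show ?thesis by (metis sorted_list_of_set.idem_if_sorted_distinct)
    qed
    moreover have "map (r(b := 0)) ?as = map r ?as" using bA Suc.prems by auto
    moreover have "(\<Sum>\<tau>\<in>?R (insert b A) (r(b := 0)) (B - {b}). ?w (B - {b}) \<tau>)
        = ?C (card (B - {b})) (map (r(b := 0)) (sorted_list_of_set (insert b A)))"
    proof (rule Suc.hyps(1))
      fix a x assume "a \<in> insert b A" "x \<in> B - {b}"
      thus "a < x" using Suc.prems(3) b(2)[of x] by force
    qed (use n finB Suc.prems in auto)
    moreover have "?R2 = ?R (insert b A) (r(b := 0)) (B - {b})"
      by (rule ranked_involutions_open[OF b3])
    ultimately show ?thesis by (simp only: n[symmetric] map_append list.map fun_upd_same)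
  qed
  also have "(\<Sum>\<tau>\<in>?R3. ?w B \<tau>) = (\<Sum>a\<in>A. \<Sum>\<tau>\<in>{\<tau> \<in> ?R A r B. \<tau> b = a}. ?w B \<tau>)"
    by (rule sum.UNION_disjoint) (use finR Suc.prems in auto)
  also have "\<dots> = (\<Sum>a\<in>A. if r a < l then
      ?C n (map (close_ranks a r) (sorted_list_of_set (A - {a}))) else 0)"
  proof (rule sum.cong)
    fix a assume a: "a \<in> A"
    show "(\<Sum>\<tau>\<in>{\<tau> \<in> ?R A r B. \<tau> b = a}. ?w B \<tau>) =
        (if r a < l then ?C n (map (close_ranks a r) (sorted_list_of_set (A - {a}))) else 0)"
    proof (cases "r a < l")
      case True
      have "a < b" using a b3 by blast
      have "(\<Sum>\<tau>\<in>{\<tau> \<in> ?R A r B. \<tau> b = a}. ?w B \<tau>) =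
          (\<Sum>\<sigma>\<in>?R (A - {a}) (close_ranks a r) (B - {b}). ?w B (\<sigma> \<circ> transpose a b))"
        by (rule sum.reindex_bij_betw[OF bij_betw_close[where r = r, OF b3 a True], symmetric])
      also have "\<dots> = (\<Sum>\<sigma>\<in>?R (A - {a}) (close_ranks a r) (B - {b}). ?w (B - {b}) \<sigma>)"
      proof (rule sum.cong)
        fix \<sigma> assume "\<sigma> \<in> ?R (A - {a}) (close_ranks a r) (B - {b})"
        hence "\<sigma> permutes (A - {a} \<union> (B - {b}))" by (simp add: ranked_involutions_def)
        hence "\<sigma> a = a" using a b3 by (intro permutes_not_in) auto
        hence "{i \<in> B. (\<sigma> \<circ> transpose a b) i = i} = {i \<in> B - {b}. \<sigma> i = i}"
          using a b3 by (auto simp: transpose_def)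
        thus "?w B (\<sigma> \<circ> transpose a b) = ?w (B - {b}) \<sigma>" by simp
      qed simp
      also have "\<dots> = ?C (card (B - {b})) (map (close_ranks a r) (sorted_list_of_set (A - {a})))"
        by (rule Suc.hyps(1)) (use n finB Suc.prems in auto)
      finally show ?thesis using True n by simp
    next
      case False
      have "{\<tau> \<in> ?R A r B. \<tau> b = a} = {}" by (rule ranked_involutions_dead[where r = r, OF b3 a False])
      thus ?thesis using False by (simp only: sum.empty if_False)
    qed
  qed simp
  also have "\<dots> = (\<Sum>s<card A. if r (?as ! s) < l then ?C n (close_arc s (map r ?as)) else 0)"
  proof -
    have "bij_betw ((!) ?as) {..<card A} A"
      using bij_betw_nth[of ?as "{..<card A}" A] Suc.prems by simp
    from sum.reindex_bij_betw[OF this, symmetric] show ?thesis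
      by (rule trans) (intro sum.cong refl, simp add: sorted_list_of_set_close[OF Suc.prems(1)])
  qed
  also have "\<dots> = (\<Sum>s | s < length (map r ?as) \<and> map r ?as ! s < l. ?C n (close_arc s (map r ?as)))"
    using Suc.prems by (intro sum.mono_neutral_cong_right) auto
  \<comment> \<open>For \<open>c = 0\<close> the fixed point leaves the ranks as they are and its
    weight is \<open>z\<close>; for \<open>c = 1\<close> it raises them to at least 1 and its weight
    is \<open>w\<close>.\<close>
  also have "y * ?C n (map (max c) (map r ?as)) + ?C n (map r ?as @ [0]) + \<dots> = ?C (Suc n) (map r ?as)"
  proof -
    have "map (max 0) xs = xs" for xs :: "nat list" by (intro map_idI) simp
    thus ?thesis using assms(4) by (cases "c = 0") (auto simp: le_Suc_eq simp del: map_map)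
  qed
  finally show ?case using Suc.hyps(2) by simp
qed

section \<open>Descending subsequences and labellings\<close>

definition descending_within :: "(nat \<Rightarrow> nat) \<Rightarrow> nat \<Rightarrow> nat \<Rightarrow> nat list \<Rightarrow> bool" where
  "descending_within \<tau> lo hi is \<longleftrightarrow> sorted_wrt (<) is \<and> sorted_wrt (>) (map \<tau> is) \<and>
     set is \<subseteq> {lo<..<hi} \<and> \<tau> ` set is \<subseteq> {lo<..<hi}"

text \<open>Positions and values inside both lie strictly between \<open>a\<close> and
  \<open>\<tau> a\<close>; position \<open>a\<close> comes first and has the largest value, position
  \<open>\<tau> a\<close> comes last and has the smallest.\<close>

lemma descending_within_wrap:
  assumes "descending_within \<tau> a (\<tau> a) is" "lo < a" "a < \<tau> a" "\<tau> a < hi" "\<tau> (\<tau> a) = a"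
  shows "descending_within \<tau> lo hi (a # is @ [\<tau> a])"
  using assms by (fastforce simp: descending_within_def sorted_wrt_append)

lemma length_descending_within:
  assumes "descending_within \<tau> lo hi is"
  shows "length is \<le> hi"
proof -
  have "distinct is" using assms by (auto simp: descending_within_def strict_sorted_iff)
  hence "length is = card (set is)" by (simp add: distinct_card)
  also have "\<dots> \<le> card {lo<..<hi}" using assms by (intro card_mono) (auto simp: descending_within_def)
  finally show ?thesis by simp
qed

text \<open>Wrapping a descending subsequence into an arc lengthens it by 2 and every fixed point inside
  an arc is one of length 1, so half of the maximal length (suitably rounded) is a labelling; there
  is no need to look for descending subsequences that consist of nested arcs.\<close>

definition inner_depth :: "(nat \<Rightarrow> nat) \<Rightarrow> nat \<Rightarrow> nat" where
  "inner_depth \<tau> a = Max (length ` {is. descending_within \<tau> a (\<tau> a) is})"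

lemma inner_depth_ge: "descending_within \<tau> a (\<tau> a) is \<Longrightarrow> length is \<le> inner_depth \<tau> a"
  unfolding inner_depth_def
  by (rule Max_ge) (auto intro!: finite_subset[of _ "{..\<tau> a}"] dest: length_descending_within)

lemma inner_depth_attained: "\<exists>is. descending_within \<tau> a (\<tau> a) is \<and> length is = inner_depth \<tau> a"
proof -
  have "finite (length ` {is. descending_within \<tau> a (\<tau> a) is})"
    by (rule finite_subset[of _ "{..\<tau> a}"]) (auto dest: length_descending_within)
  moreover have "descending_within \<tau> a (\<tau> a) []" by (simp add: descending_within_def)
  ultimately have "inner_depth \<tau> a \<in> length ` {is. descending_within \<tau> a (\<tau> a) is}"
    unfolding inner_depth_def by (intro Max_in) auto
  thus ?thesis by auto
qed

lemma labelling_inner_depth: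
  assumes inv: "\<And>x. \<tau> (\<tau> x) = x" and perm: "\<tau> permutes {1..n}" and m: "m + c = 2 * l + 1" "c \<le> 1"
    and nodesc: "\<And>is. descending_within \<tau> 0 (Suc n) is \<Longrightarrow> length is \<le> m"
  shows "labelling l c {1..n} \<tau> (\<lambda>a. (inner_depth \<tau> a + c) div 2)"
  unfolding labelling_def
proof (intro conjI ballI impI)
  fix a assume a: "a \<in> {1..n}" "a < \<tau> a"
  obtain "is" where "is": "descending_within \<tau> a (\<tau> a) is" "length is = inner_depth \<tau> a"
    using inner_depth_attained by blast
  have "\<tau> a \<le> n" using permutes_in_image[OF perm, of a] a by auto
  hence "descending_within \<tau> 0 (Suc n) (a # is @ [\<tau> a])"
    using a "is" inv by (intro descending_within_wrap) auto
  \<comment> \<open>As \<open>m = 2 * l + 1 - c\<close>, this bounds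
    \<open>inner_depth \<tau> a + c\<close> by \<open>2 * l - 1\<close>.\<close>
  from nodesc[OF this] "is" have "inner_depth \<tau> a + 2 \<le> m" by simp
  thus "(inner_depth \<tau> a + c) div 2 < l" using m by linarith
next
  fix a a' assume "a \<in> {1..n}" "a' \<in> {1..n}" and a: "a < a' \<and> a' < \<tau> a' \<and> \<tau> a' < \<tau> a"
  obtain "is" where "is": "descending_within \<tau> a' (\<tau> a') is" "length is = inner_depth \<tau> a'"
    using inner_depth_attained by blast
  have "descending_within \<tau> a (\<tau> a) (a' # is @ [\<tau> a'])"
    using a "is" inv by (intro descending_within_wrap) auto
  from inner_depth_ge[OF this] "is" have "inner_depth \<tau> a' + 2 \<le> inner_depth \<tau> a" by simp
  thus "(inner_depth \<tau> a' + c) div 2 < (inner_depth \<tau> a + c) div 2" by linarith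
next
  fix a b assume "a \<in> {1..n}" "b \<in> {1..n}" and b: "a < b \<and> b < \<tau> a \<and> \<tau> b = b"
  hence "descending_within \<tau> a (\<tau> a) [b]" by (simp add: descending_within_def)
  from inner_depth_ge[OF this] have "inner_depth \<tau> a \<ge> 1" by simp
  \<comment> \<open>For \<open>c = 1\<close> the half is rounded up, so depth 1 already gives label
    1.\<close>
  thus "c \<le> (inner_depth \<tau> a + c) div 2" using m(2) by linarith
qed

lemma label_chain:
  fixes h :: "nat \<Rightarrow> nat"
  assumes "\<And>k. p \<le> k \<Longrightarrow> k < q \<Longrightarrow> h (u (Suc k)) < h (u k)" "p \<le> q"
  shows "h (u q) + (q - p) \<le> h (u p)"
  using assms(2,1)
proof (induction rule: dec_induct)
  case (step q)
  have "h (u q) + (q - p) \<le> h (u p)" using step.prems by (intro step.IH) auto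
  moreover have "h (u (Suc q)) < h (u q)" using step.hyps by (intro step.prems) auto
  ultimately show ?case using step.hyps by linarith
qed simp

lemma label_chain_rev:
  fixes h :: "nat \<Rightarrow> nat"
  assumes "\<And>k. p \<le> k \<Longrightarrow> k < q \<Longrightarrow> h (u k) < h (u (Suc k))" "p \<le> q"
  shows "h (u p) + (q - p) \<le> h (u q)"
  using assms(2,1)
proof (induction rule: dec_induct)
  case (step q)
  have "h (u p) + (q - p) \<le> h (u q)" using step.prems by (intro step.IH) auto
  moreover have "h (u q) < h (u (Suc q))" using step.hyps by (intro step.prems) auto
  ultimately show ?case using step.hyps by linarith
qed simp

text \<open>If the entry with index \<open>l\<close> lies above the diagonal, all entries before it are left ends of
  arcs, each nested in the previous one; if it lies below, all entries after it are right ends.\<close>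

lemma labelling_length:
  assumes inv: "\<And>x. \<tau> (\<tau> x) = x" and perm: "\<tau> permutes {1..n}" and m: "m + c = 2 * l + 1" "c \<le> 1" "m \<ge> 1"
    and lab: "labelling l c {1..n} \<tau> h"
    and desc: "sorted_wrt (<) is" "sorted_wrt (>) (map \<tau> is)" "set is \<subseteq> {1..n}"
  shows "length is \<le> m"
proof (rule ccontr)
  assume "\<not> length is \<le> m"
  hence len: "m < length is" by simp
  let ?x = "\<lambda>k. is ! k"
  have less: "?x j < ?x k" "\<tau> (?x k) < \<tau> (?x j)" if "j < k" "k \<le> m" for j k
    using sorted_wrt_nth_less[OF desc(1) that(1)] sorted_wrt_nth_less[OF desc(2) that(1)] that len by auto
  have mem: "?x k \<in> {1..n}" if "k \<le> m" for k using that desc(3) len by (meson le_less_trans nth_mem subsetD)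
  have mem': "\<tau> (?x k) \<in> {1..n}" if "k \<le> m" for k
    using permutes_in_image[OF perm, of "?x k"] mem[OF that] by simp
  have lt: "h a < l" if "a \<in> {1..n}" "a < \<tau> a" for a using lab that unfolding labelling_def by blast
  have nest: "h a' < h a" if "a \<in> {1..n}" "a' \<in> {1..n}" "a < a'" "a' < \<tau> a'" "\<tau> a' < \<tau> a" for a a'
    using lab that unfolding labelling_def by blast
  have covered: "c \<le> h a" if "a \<in> {1..n}" "b \<in> {1..n}" "a < b" "b < \<tau> a" "\<tau> b = b" for a b
    using lab that unfolding labelling_def by blast
  \<comment> \<open>Before a left end all entries are left ends too, and labels grow by at least 1
    at each step outwards; the outermost label would reach \<open>l\<close>.\<close>
  have openers: False if "q \<le> m" "?x q < \<tau> (?x q)" "l \<le> h (?x q) + q" for q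
  proof -
    have o: "?x k < \<tau> (?x k)" if "k \<le> q" for k
      using less[of k q] that \<open>q \<le> m\<close> \<open>?x q < \<tau> (?x q)\<close> by (cases "k = q") auto
    have "h (?x q) + (q - 0) \<le> h (?x 0)"
    proof (rule label_chain[where u = ?x])
      fix k assume "k < q"
      thus "h (?x (Suc k)) < h (?x k)"
        by (intro nest[OF mem mem less(1) o less(2)]) (use \<open>q \<le> m\<close> in auto)
    qed simp
    moreover have "h (?x 0) < l" by (rule lt[OF mem o]) auto
    ultimately show False using that by simp
  qed
  \<comment> \<open>The mirror image, with nesting growing from index \<open>p\<close> to the last
    index \<open>m\<close>: at least \<open>l\<close> steps.\<close>
  have closers: False if "p \<le> m" "\<tau> (?x p) < ?x p" "l + p \<le> m" for p
  proof -
    have o: "\<tau> (?x k) < ?x k" if "p \<le> k" "k \<le> m" for k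
      using less[of p k] that \<open>\<tau> (?x p) < ?x p\<close> by (cases "k = p") auto
    have "h (\<tau> (?x p)) + (m - p) \<le> h (\<tau> (?x m))"
    proof (rule label_chain_rev[where u = "\<lambda>k. \<tau> (?x k)"])
      fix k assume "p \<le> k" "k < m"
      thus "h (\<tau> (?x k)) < h (\<tau> (?x (Suc k)))"
        by (intro nest[OF mem' mem' less(2), unfolded inv] o less(1)) auto
    qed (use that in simp)
    moreover have "h (\<tau> (?x m)) < l"
      by (rule lt[OF mem', unfolded inv]) (use o that in auto)
    ultimately show False using that by simp
  qed
  have lm: "l \<le> m" using m by simp
  show False
  proof (cases "?x l" "\<tau> (?x l)" rule: linorder_cases)
    case less
    thus ?thesis using openers[of l] lm by simp
  next
    case greater
    thus ?thesis using closers[of l] lm m by simp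
  next
    case equal
    show ?thesis
    \<comment> \<open>The middle entry is a fixed point. For \<open>c = 0\<close> the entries after
      it give \<open>m - Suc l = l\<close> nesting steps; for \<open>c = 1\<close> the entry before
      it is an arc enclosing it, whose label at least 1 makes up for the missing step.\<close>
    proof (cases "c = 0")
      case True
      hence "Suc l \<le> m" using m by simp
      moreover have "\<tau> (?x (Suc l)) < ?x (Suc l)"
        using equal less[of l "Suc l"] \<open>Suc l \<le> m\<close> by auto
      ultimately show ?thesis using closers[of "Suc l"] m True by auto
    next
      case False
      then obtain q where q: "l = Suc q" using m by (cases l) auto
      have "?x q < ?x l" "?x l < \<tau> (?x q)" using less[of q l] q lm equal by auto
      moreover from this have "c \<le> h (?x q)"
        using lm q equal by (intro covered[OF mem mem]) auto
      ultimately show ?thesis using openers[of q] q lm False by auto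
    qed
  qed
qed

lemma involutions_eq_ranked:
  assumes m: "m + c = 2 * l + 1" "c \<le> 1" "m \<ge> 1"
  shows "{\<tau>. (n, \<tau>) \<in> involutions m} = ranked_involutions l c {} r {1..n}"
proof (intro equalityI subsetI)
  fix \<tau> assume "\<tau> \<in> {\<tau>. (n, \<tau>) \<in> involutions m}"
  hence perm: "\<tau> permutes {1..n}" and inv: "\<tau> \<circ> \<tau> = id"
    and nd: "\<And>ds. descending_subsequence ds (n, \<tau>) \<Longrightarrow> length ds \<noteq> m + 1"
    by (auto simp: involutions_def is_involution_def)
  have "length is \<le> m" if "descending_within \<tau> 0 (Suc n) is" for "is"
  proof (rule ccontr)
    assume "\<not> length is \<le> m"
    \<comment> \<open>Only the exact length \<open>m + 1\<close> is forbidden, so a longer sequence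
      is cut down to it.\<close>
    let ?is = "take (m + 1) is"
    have "set ?is \<subseteq> {1..n}" using that set_take_subset[of "m + 1" "is"] by (fastforce simp: descending_within_def)
    moreover have "sorted_wrt (<) ?is" "sorted_wrt (>) (map \<tau> ?is)"
      using that by (simp_all add: descending_within_def sorted_wrt_take take_map[symmetric] del: take_map)
    ultimately have "descending_subsequence (map \<tau> ?is) (n, \<tau>)"
      by (auto simp: descending_subsequence_def)
    from nd[OF this] \<open>\<not> length is \<le> m\<close> show False by simp
  qed
  hence "labelling l c {1..n} \<tau> (\<lambda>a. (inner_depth \<tau> a + c) div 2)"
    using fun_cong[OF inv] perm m by (intro labelling_inner_depth) auto
  thus "\<tau> \<in> ranked_involutions l c {} r {1..n}"
    using perm inv by (auto simp: ranked_involutions_def)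
next
  fix \<tau> assume "\<tau> \<in> ranked_involutions l c {} r {1..n}"
  then obtain h where perm: "\<tau> permutes {1..n}" and inv: "\<tau> \<circ> \<tau> = id" and lab: "labelling l c {1..n} \<tau> h"
    by (auto simp: ranked_involutions_def)
  have "length ds \<noteq> m + 1" if ds: "descending_subsequence ds (n, \<tau>)" for ds
  proof -
    obtain "is" where "is": "set is \<subseteq> {1..n}" "sorted_wrt (<) is" "ds = map \<tau> is" "sorted_wrt (>) ds"
      using ds by (auto simp: descending_subsequence_def)
    have "length is \<le> m"
      using fun_cong[OF inv] by (intro labelling_length[OF _ perm m lab]) (use "is" in auto)
    thus ?thesis using "is" by simp
  qed
  thus "\<tau> \<in> {\<tau>. (n, \<tau>) \<in> involutions m}"
    using perm inv by (auto simp: involutions_def is_involution_def)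
qed

section \<open>Extracting the involutions with \<open>p\<close> fixed points\<close>

lemma sum_involutions:
  fixes y :: rat
  assumes "m + c = 2 * l + 1" "c \<le> 1" "m \<ge> 1"
  shows "(\<Sum>\<tau> | (n, \<tau>) \<in> involutions m. y ^ fixed_points (n, \<tau>)) =
    completions l (if c = 0 then y else 0) (if c = 0 then 0 else y) n []"
proof -
  have "(\<Sum>\<tau>\<in>ranked_involutions l c {} r {1..n}. y ^ card {i \<in> {1..n}. \<tau> i = i}) =
    completions l (if c = 0 then y else 0) (if c = 0 then 0 else y) (card {1..n}) (map r (sorted_list_of_set {}))" for r
    by (rule sum_ranked_involutions) (use assms in auto)
  thus ?thesis unfolding involutions_eq_ranked[OF assms, of n id] fixed_points_def by simp
qed

text \<open>Polynomials that agree as functions on an infinite field are equal.\<close>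

lemma power_sum_coeffs_eq:
  fixes a b :: "nat \<Rightarrow> rat"
  assumes "\<And>y. (\<Sum>i\<le>n. a i * y ^ i) = (\<Sum>i\<le>n. b i * y ^ i)" "k \<le> n"
  shows "a k = b k"
proof -
  let ?P = "\<lambda>a. \<Sum>i\<le>n. monom (a i :: rat) i"
  have "poly (?P a) = poly (?P b)"
    using assms(1) by (simp add: fun_eq_iff poly_sum poly_monom)
  hence "coeff (?P a) k = coeff (?P b) k" by (simp add: poly_eq_poly_eq_iff)
  moreover have "coeff (?P c) k = c k" for c
    using assms(2) by (simp add: coeff_sum)
  ultimately show ?thesis by simp
qed

lemma finite_involutions: "finite {\<tau>. (n, \<tau>) \<in> involutions m}"
  by (rule finite_subset[OF _ finite_permutations[of "{1..n}"]])
    (auto simp: involutions_def is_involution_def)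

lemma has_sum_involutions:
  assumes "\<And>n. of_nat (card {\<tau>. (n, \<tau>) \<in> involutions m \<and> fixed_points (n, \<tau>) = p}) = fact n * fps_nth F n"
  shows "((\<lambda>\<sigma>. term_fps (1 / fact (fst \<sigma>)) (fst \<sigma>)) has_sum F)
    {\<sigma> \<in> involutions m. fixed_points \<sigma> = p}"
proof -
  let ?A = "{\<sigma> \<in> involutions m. fixed_points \<sigma> = p}"
  let ?T = "\<lambda>n. {\<tau>. (n, \<tau>) \<in> involutions m \<and> fixed_points (n, \<tau>) = p}"
  have A: "{\<sigma> \<in> ?A. fst \<sigma> = n} = Pair n ` ?T n" for n by force
  have fin: "finite (?T n)" for n by (rule finite_subset[OF _ finite_involutions]) auto
  have "finite {\<sigma> \<in> ?A. fst \<sigma> = n}" for n unfolding A by (intro finite_imageI fin)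
  hence "((\<lambda>\<sigma>. term_fps (1 / fact (fst \<sigma>)) (fst \<sigma>)) has_sum
      Abs_fps (\<lambda>n. \<Sum>\<sigma> | \<sigma> \<in> ?A \<and> fst \<sigma> = n. 1 / fact (fst \<sigma>))) ?A"
    by (rule has_sum_term_fps)
  also have "Abs_fps (\<lambda>n. \<Sum>\<sigma> | \<sigma> \<in> ?A \<and> fst \<sigma> = n. 1 / fact (fst \<sigma>)) = F"
  proof (rule fps_ext)
    fix n
    have "(\<Sum>\<sigma> | \<sigma> \<in> ?A \<and> fst \<sigma> = n. 1 / fact (fst \<sigma>)) = (\<Sum>\<sigma> | \<sigma> \<in> ?A \<and> fst \<sigma> = n. 1 / fact n :: rat)"
      by (rule sum.cong) auto
    also have "\<dots> = of_nat (card (?T n)) / fact n"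
      unfolding A by (simp add: card_image inj_on_def)
    finally show "fps_nth (Abs_fps (\<lambda>n. \<Sum>\<sigma> | \<sigma> \<in> ?A \<and> fst \<sigma> = n. 1 / fact (fst \<sigma>))) n = fps_nth F n"
      using assms[of n] by simp
  qed
  finally show ?thesis .
qed

text \<open>Both sides are coefficients of \<open>y ^ p\<close> in the weighted count of fixed
  points. For this \<open>M\<close> has to bound \<open>p\<close> as well as the possible numbers of
  fixed points, hence the later choice \<open>M = n + p\<close>.\<close>

lemma card_involutions_eq:
  assumes m: "m + c = 2 * l + 1" "c \<le> 1" "m \<ge> 1" and p: "p \<le> M" and n: "n \<le> M"
    and F: "\<And>y. completions l (if c = 0 then y else 0) (if c = 0 then 0 else y) n []
      = (\<Sum>i\<le>M. (fact n * fps_nth (F i) n) * y ^ i)"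
  shows "of_nat (card {\<tau>. (n, \<tau>) \<in> involutions m \<and> fixed_points (n, \<tau>) = p}) = fact n * fps_nth (F p) n"
proof (rule power_sum_coeffs_eq[OF _ p])
  fix y :: rat
  let ?I = "{\<tau>. (n, \<tau>) \<in> involutions m}"
  have fp: "fixed_points (n, \<tau>) \<le> M" for \<tau>
  proof -
    have "card {i \<in> {1..n}. \<tau> i = i} \<le> card {1..n}" by (intro card_mono) auto
    thus ?thesis using n by (simp add: fixed_points_def)
  qed
  have "(\<Sum>i\<le>M. (fact n * fps_nth (F i) n) * y ^ i) = (\<Sum>\<tau>\<in>?I. y ^ fixed_points (n, \<tau>))"
    unfolding F[symmetric] by (rule sum_involutions[OF m, symmetric])
  also have "\<dots> = (\<Sum>i\<le>M. \<Sum>\<tau> | \<tau> \<in> ?I \<and> fixed_points (n, \<tau>) = i. y ^ fixed_points (n, \<tau>))"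
    by (rule sum.group[symmetric]) (use finite_involutions fp in auto)
  also have "\<dots> = (\<Sum>i\<le>M. of_nat (card {\<tau>. (n, \<tau>) \<in> involutions m \<and> fixed_points (n, \<tau>) = i}) * y ^ i)"
    by (intro sum.cong) auto
  finally show "(\<Sum>i\<le>M. of_nat (card {\<tau>. (n, \<tau>) \<in> involutions m \<and> fixed_points (n, \<tau>) = i}) * y ^ i)
      = (\<Sum>i\<le>M. (fact n * fps_nth (F i) n) * y ^ i)" by simp
qed

theorem theorem3:
  fixes m p :: nat
  assumes "m \<ge> 1"
  shows
    "(\<forall>l::nat. m = 2 * l + 1 \<longrightarrow>
        ((\<lambda>\<sigma>. term_fps (1 / fact (fst \<sigma>)) (fst \<sigma>)) has_sum
          term_fps (1 / fact p) p * det1 l (\<lambda>i j. I_fps (i - j) - I_fps (i + j)))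
        {\<sigma> \<in> involutions m. fixed_points \<sigma> = p}) \<and>
     (\<forall>l::nat. m = 2 * l \<longrightarrow>
        ((\<lambda>\<sigma>. term_fps (1 / fact (fst \<sigma>)) (fst \<sigma>)) has_sum
          det1 l (\<lambda>i j. if i = 1 then I_fps (int p + int l - j) - I_fps (int p + int l + j)
                        else I_fps (i + j - 1) - I_fps (i - j - 1)))
        {\<sigma> \<in> involutions m. fixed_points \<sigma> = p})"
proof (intro conjI allI impI)
  fix l assume l: "m = 2 * l + 1"
  let ?D = "det1 l (\<lambda>i j. I_fps (i - j) - I_fps (i + j))"
  show "((\<lambda>\<sigma>. term_fps (1 / fact (fst \<sigma>)) (fst \<sigma>)) has_sum term_fps (1 / fact p) p * ?D)
      {\<sigma> \<in> involutions m. fixed_points \<sigma> = p}"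
  proof (rule has_sum_involutions, rule card_involutions_eq[where c = 0 and l = l and M = "n + p" for n])
    fix n :: nat and y :: rat
    have term_nth: "fps_nth (term_fps (1 / fact i) i * ?D) n
        = (if i \<le> n then fps_nth ?D (n - i) / fact i else 0)" for i
      by (simp add: term_fps_def mult.assoc fps_X_power_mult_nth)
    have "fps_nth (fps_exp y * ?D) n = (\<Sum>i\<le>n. y ^ i / fact i * fps_nth ?D (n - i))"
      by (simp add: fps_mult_nth atLeast0AtMost)
    \<comment> \<open>The coefficient of \<open>y ^ i\<close> in \<open>fps_exp y\<close> is
      \<open>t^i / i!\<close>, the factor in front of the determinant; terms with
      \<open>i > n\<close> vanish.\<close>
    also have "\<dots> = (\<Sum>i\<le>n + p. fps_nth (term_fps (1 / fact i) i * ?D) n * y ^ i)"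
      unfolding term_nth by (intro sum.mono_neutral_cong_left) auto
    finally show "completions l (if (0::nat) = 0 then y else 0) (if (0::nat) = 0 then 0 else y) n []
        = (\<Sum>i\<le>n + p. (fact n * fps_nth (term_fps (1 / fact i) i * ?D) n) * y ^ i)"
      using completions_odd[of n y l] by (simp add: sum_distrib_left mult.assoc)
  qed (use l in auto)
next
  fix l assume l: "m = 2 * l"
  let ?D = "\<lambda>p. det1 l (\<lambda>i j. if i = 1 then I_fps (int p + int l - j) - I_fps (int p + int l + j)
                        else I_fps (i + j - 1) - I_fps (i - j - 1))"
  show "((\<lambda>\<sigma>. term_fps (1 / fact (fst \<sigma>)) (fst \<sigma>)) has_sum ?D p)
      {\<sigma> \<in> involutions m. fixed_points \<sigma> = p}"
  proof (rule has_sum_involutions, rule card_involutions_eq[where c = 1 and l = l and M = "n + p" and F = ?D for n])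
    fix n :: nat and y :: rat
    have "l > 0" using l assms by simp
    from completions_even[OF this, of n "n + p" y]
    show "completions l (if (1::nat) = 0 then y else 0) (if (1::nat) = 0 then 0 else y) n []
        = (\<Sum>i\<le>n + p. (fact n * fps_nth (?D i) n) * y ^ i)"
      by (simp add: fps_sum_nth sum_distrib_left mult_ac)
  qed (use l assms in auto)
qed

end
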